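(* Extension Roman Hitting Function, parameterized by the weight $\omega(f)=\sum_{x\in X}f(x)$ of the given function $f$, belongs to W[3].
   Context: A hypergraph is $H=(X,(s_i)_{i\in I})$ with finite $X$, finite index set $I$, $s_i\subseteq X$ (repetitions allowed). A correspondence is a map $\tau:X\to I$ with $x\in s_{\tau(x)}$ for all $x$. A function $g:X\to\{0,1,2\}$ is a Roman hitting function (rhf) if for every $i\in I$ there is $x\in s_i$ with $g(x)=2$ or there is $x$ with $\tau(x)=i$ and $g(x)=1$. Functions are ordered pointwise; an rhf $g$ is minimal if every rhf $h\le g$ equals $g$. Extension Roman Hitting Function: given $H$, $\tau$ and $f:X\to\{0,1,2\}$, decide whether there is a minimal rhf $g$ with $f\le g$. *)

theory Defs
  imports Main "HOL-Library.FuncSet"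
begin

section \<open>Roman hitting functions\<close>

record ('a, 'i) hypergraph =
  verts :: "'a set"
  idx :: "'i set"
  edge :: "'i \<Rightarrow> 'a set"

definition is_hypergraph :: "('a, 'i) hypergraph \<Rightarrow> bool" where
  "is_hypergraph H \<longleftrightarrow>
     finite (verts H) \<and> finite (idx H) \<and> (\<forall>i\<in>idx H. edge H i \<subseteq> verts H)"

definition correspondence :: "('a, 'i) hypergraph \<Rightarrow> ('a \<Rightarrow> 'i) \<Rightarrow> bool" where
  "correspondence H \<tau> \<longleftrightarrow> \<tau> \<in> verts H \<rightarrow> idx H \<and> (\<forall>x\<in>verts H. x \<in> edge H (\<tau> x))"

definition fun_le :: "('a, 'i) hypergraph \<Rightarrow> ('a \<Rightarrow> nat) \<Rightarrow> ('a \<Rightarrow> nat) \<Rightarrow> bool" where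
  "fun_le H f g \<longleftrightarrow> (\<forall>x\<in>verts H. f x \<le> g x)"

definition rhf :: "('a, 'i) hypergraph \<Rightarrow> ('a \<Rightarrow> 'i) \<Rightarrow> ('a \<Rightarrow> nat) \<Rightarrow> bool" where
  "rhf H \<tau> g \<longleftrightarrow> g \<in> verts H \<rightarrow> {0, 1, 2} \<and>
     (\<forall>i\<in>idx H. (\<exists>x\<in>edge H i. g x = 2) \<or> (\<exists>x\<in>verts H. \<tau> x = i \<and> g x = 1))"

definition minimal_rhf :: "('a, 'i) hypergraph \<Rightarrow> ('a \<Rightarrow> 'i) \<Rightarrow> ('a \<Rightarrow> nat) \<Rightarrow> bool" where
  "minimal_rhf H \<tau> g \<longleftrightarrow> rhf H \<tau> g \<and>
     (\<forall>h. rhf H \<tau> h \<and> fun_le H h g \<longrightarrow> (\<forall>x\<in>verts H. h x = g x))"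

definition weight :: "('a, 'i) hypergraph \<Rightarrow> ('a \<Rightarrow> nat) \<Rightarrow> nat" where
  "weight H f = (\<Sum>x\<in>verts H. f x)"

definition extension_rhf_yes ::
    "('a, 'i) hypergraph \<Rightarrow> ('a \<Rightarrow> 'i) \<Rightarrow> ('a \<Rightarrow> nat) \<Rightarrow> bool" where
  "extension_rhf_yes H \<tau> f \<longleftrightarrow> (\<exists>g. minimal_rhf H \<tau> g \<and> fun_le H f g)"

section \<open>Random access machines\<close>

text \<open>
  Registers hold natural numbers and are initially zero; the input is a word that is read once from
  left to right, and the output is a write-only word.  There is no multiplication, so every
  instruction at most doubles the largest register content: counting each instruction as one step
  is polynomially equivalent to Turing machine time.
\<close>

datatype instr =
    Const nat nat
  | Copy nat nat
  | Add nat nat nat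
  | Sub nat nat nat
  | Load nat nat
  | Store nat nat
  | Read nat
  | Write nat
  | Jump_zero nat nat

datatype config =
  Config (pc: nat) (mem: "nat \<Rightarrow> nat") (inp: "bool list") (outp: "bool list")

text \<open>Reading past the end of the input yields 2.  Writing a register emits whether it is nonzero.\<close>

fun exec_instr :: "instr \<Rightarrow> config \<Rightarrow> config" where
  "exec_instr (Const r n) (Config p M u v) = Config (Suc p) (M(r := n)) u v"
| "exec_instr (Copy r a) (Config p M u v) = Config (Suc p) (M(r := M a)) u v"
| "exec_instr (Add r a b) (Config p M u v) = Config (Suc p) (M(r := M a + M b)) u v"
| "exec_instr (Sub r a b) (Config p M u v) = Config (Suc p) (M(r := M a - M b)) u v"
| "exec_instr (Load r a) (Config p M u v) = Config (Suc p) (M(r := M (M a))) u v"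
| "exec_instr (Store a r) (Config p M u v) = Config (Suc p) (M(M a := M r)) u v"
| "exec_instr (Read r) (Config p M u v) =
     Config (Suc p) (M(r := (case u of [] \<Rightarrow> 2 | b # _ \<Rightarrow> of_bool b))) (tl u) v"
| "exec_instr (Write r) (Config p M u v) = Config (Suc p) M u (v @ [M r \<noteq> 0])"
| "exec_instr (Jump_zero r l) (Config p M u v) = Config (if M r = 0 then l else Suc p) M u v"

definition halted :: "instr list \<Rightarrow> config \<Rightarrow> bool" where
  "halted P c \<longleftrightarrow> length P \<le> pc c"

definition ram_step :: "instr list \<Rightarrow> config \<Rightarrow> config" where
  "ram_step P c = (if halted P c then c else exec_instr (P ! pc c) c)"

definition halts_within :: "instr list \<Rightarrow> bool list \<Rightarrow> bool list \<Rightarrow> nat \<Rightarrow> bool" where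
  "halts_within P u v t \<longleftrightarrow>
     (let c = (ram_step P ^^ t) (Config 0 (\<lambda>_. 0) u []) in halted P c \<and> outp c = v)"

section \<open>Binary encodings\<close>

text \<open>
  All encodings are prefix-free.  Numbers are in unary; they only ever denote vertices, edge
  indices, wires, function values and parameters.
\<close>

definition enc_nat :: "nat \<Rightarrow> bool list" where
  "enc_nat n = replicate n True @ [False]"

definition enc_list :: "('a \<Rightarrow> bool list) \<Rightarrow> 'a list \<Rightarrow> bool list" where
  "enc_list e xs = concat (map (\<lambda>x. True # e x) xs) @ [False]"

section \<open>Parameterized problems and fpt-reductions\<close>

type_synonym parameterized_problem = "(bool list \<times> nat) set"

definition computable :: "(nat \<Rightarrow> nat) \<Rightarrow> bool" where
  "computable g \<longleftrightarrow> (\<exists>P. \<forall>k. \<exists>t. halts_within P (enc_nat k) (enc_nat (g k)) t)"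

definition fpt_reducible :: "parameterized_problem \<Rightarrow> parameterized_problem \<Rightarrow> bool" where
  "fpt_reducible A B \<longleftrightarrow>
     (\<exists>P R \<kappa> g h c. computable g \<and> computable h \<and>
        (\<forall>x k. halts_within P (enc_nat k @ x) (enc_nat (\<kappa> x k) @ R x k)
                  (g k * (length x + 1) ^ c) \<and>
               \<kappa> x k \<le> h k \<and>
               ((x, k) \<in> A \<longleftrightarrow> (R x k, \<kappa> x k) \<in> B)))"

section \<open>Circuits and the W-hierarchy\<close>

text \<open>
  The gates are listed in a topological order.  Wires \<open>0, \<dots>, n - 1\<close> are the inputs, where \<open>n\<close> is
  the number of inputs, and wire \<open>n + j\<close> is the output of gate \<open>j\<close>.
\<close>

datatype gate = Not_gate nat | And_gate "nat list" | Or_gate "nat list"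

datatype circuit = Circuit (inputs: nat) (gates: "gate list") (out_wire: nat)

fun fanin :: "gate \<Rightarrow> nat list" where
  "fanin (Not_gate u) = [u]"
| "fanin (And_gate us) = us"
| "fanin (Or_gate us) = us"

definition wf_circuit :: "circuit \<Rightarrow> bool" where
  "wf_circuit C \<longleftrightarrow> out_wire C < inputs C + length (gates C) \<and>
     (\<forall>j<length (gates C). \<forall>u\<in>set (fanin (gates C ! j)). u < inputs C + j)"

fun gate_val :: "bool list \<Rightarrow> gate \<Rightarrow> bool" where
  "gate_val vs (Not_gate u) = (\<not> vs ! u)"
| "gate_val vs (And_gate us) = (\<forall>u\<in>set us. vs ! u)"
| "gate_val vs (Or_gate us) = (\<exists>u\<in>set us. vs ! u)"

text \<open>An assignment is given by the set of inputs that are set to true.\<close>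

definition wire_vals :: "circuit \<Rightarrow> nat set \<Rightarrow> bool list" where
  "wire_vals C S =
     foldl (\<lambda>vs g. vs @ [gate_val vs g]) (map (\<lambda>i. i \<in> S) [0..<inputs C]) (gates C)"

definition satisfies :: "circuit \<Rightarrow> nat set \<Rightarrow> bool" where
  "satisfies C S \<longleftrightarrow> wire_vals C S ! out_wire C"

definition is_gate :: "circuit \<Rightarrow> nat \<Rightarrow> bool" where
  "is_gate C w \<longleftrightarrow> inputs C \<le> w \<and> w < inputs C + length (gates C)"

definition gate_at :: "circuit \<Rightarrow> nat \<Rightarrow> gate" where
  "gate_at C w = gates C ! (w - inputs C)"

definition feeds :: "circuit \<Rightarrow> nat \<Rightarrow> nat \<Rightarrow> bool" where
  "feeds C u w \<longleftrightarrow> is_gate C w \<and> u \<in> set (fanin (gate_at C w))"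

definition large_gate :: "circuit \<Rightarrow> nat \<Rightarrow> bool" where
  "large_gate C w \<longleftrightarrow> is_gate C w \<and> 2 < length (fanin (gate_at C w))"

definition path_to_output :: "circuit \<Rightarrow> nat list \<Rightarrow> bool" where
  "path_to_output C ws \<longleftrightarrow> ws \<noteq> [] \<and> successively (feeds C) ws \<and> last ws = out_wire C"

text \<open>
  Gates of fan-in zero (constants) are allowed, hence paths need not start at an input.
\<close>

definition depth_at_most :: "circuit \<Rightarrow> nat \<Rightarrow> bool" where
  "depth_at_most C d \<longleftrightarrow> (\<forall>ws. path_to_output C ws \<longrightarrow> length (filter (is_gate C) ws) \<le> d)"

definition weft_at_most :: "circuit \<Rightarrow> nat \<Rightarrow> bool" where
  "weft_at_most C t \<longleftrightarrow> (\<forall>ws. path_to_output C ws \<longrightarrow> length (filter (large_gate C) ws) \<le> t)"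

fun enc_gate :: "gate \<Rightarrow> bool list" where
  "enc_gate (Not_gate u) = [False] @ enc_nat u"
| "enc_gate (And_gate us) = [True, False] @ enc_list enc_nat us"
| "enc_gate (Or_gate us) = [True, True] @ enc_list enc_nat us"

definition enc_circuit :: "circuit \<Rightarrow> bool list" where
  "enc_circuit C = enc_nat (inputs C) @ enc_list enc_gate (gates C) @ enc_nat (out_wire C)"

definition weighted_circuit_sat :: "nat \<Rightarrow> nat \<Rightarrow> parameterized_problem" where
  "weighted_circuit_sat t d =
     {(enc_circuit C, k) | C k. wf_circuit C \<and> weft_at_most C t \<and> depth_at_most C d \<and>
        (\<exists>S\<subseteq>{..<inputs C}. card S = k \<and> satisfies C S)}"

definition W_class :: "nat \<Rightarrow> parameterized_problem set" where
  "W_class t = {A. \<exists>d. fpt_reducible A (weighted_circuit_sat t d)}"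

section \<open>Extension Roman Hitting Function as a parameterized problem\<close>

text \<open>
  Up to renaming, the vertices of an instance are \<open>0, \<dots>, n - 1\<close> and its edge indices are
  \<open>0, \<dots>, m - 1\<close>.  The hypergraph is written down as its incidence matrix, edge by edge.
\<close>

definition nat_hypergraph :: "nat \<Rightarrow> nat \<Rightarrow> (nat \<Rightarrow> nat set) \<Rightarrow> (nat, nat) hypergraph" where
  "nat_hypergraph n m s = \<lparr>verts = {..<n}, idx = {..<m}, edge = s\<rparr>"

definition enc_instance ::
    "nat \<Rightarrow> nat \<Rightarrow> (nat \<Rightarrow> nat set) \<Rightarrow> (nat \<Rightarrow> nat) \<Rightarrow> (nat \<Rightarrow> nat) \<Rightarrow> bool list" where
  "enc_instance n m s \<tau> f =
     enc_nat n @ enc_nat m @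
     concat (map (\<lambda>i. map (\<lambda>x. x \<in> s i) [0..<n]) [0..<m]) @
     concat (map (\<lambda>x. enc_nat (\<tau> x)) [0..<n]) @
     concat (map (\<lambda>x. enc_nat (f x)) [0..<n])"

definition extension_roman_hitting_function :: parameterized_problem where
  "extension_roman_hitting_function =
     {(enc_instance n m s \<tau> f, weight (nat_hypergraph n m s) f) | n m s \<tau> f.
        is_hypergraph (nat_hypergraph n m s) \<and>
        correspondence (nat_hypergraph n m s) \<tau> \<and>
        f \<in> verts (nat_hypergraph n m s) \<rightarrow> {0, 1, 2} \<and>
        extension_rhf_yes (nat_hypergraph n m s) \<tau> f}"

section \<open>The encodings are unambiguous\<close>

lemma enc_nat_prefix_free: "enc_nat m @ u = enc_nat n @ v \<longleftrightarrow> m = n \<and> u = v"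
proof (induction m arbitrary: n)
  case 0
  then show ?case by (cases n) (auto simp: enc_nat_def)
next
  case (Suc m)
  then show ?case by (cases n) (auto simp: enc_nat_def)
qed

lemma enc_list_prefix_free:
  assumes "\<And>x y u v. e x @ u = e y @ v \<longleftrightarrow> x = y \<and> u = v"
  shows "enc_list e xs @ u = enc_list e ys @ v \<longleftrightarrow> xs = ys \<and> u = v"
proof (induction xs arbitrary: ys)
  case Nil
  then show ?case by (cases ys) (auto simp: enc_list_def)
next
  case (Cons x xs)
  then show ?case using assms by (cases ys) (auto simp: enc_list_def)
qed

lemma enc_gate_prefix_free: "enc_gate g @ u = enc_gate g' @ v \<longleftrightarrow> g = g' \<and> u = v"
  by (cases g; cases g') (simp_all add: enc_nat_prefix_free enc_list_prefix_free)

lemma enc_circuit_inject: "enc_circuit C = enc_circuit C' \<longleftrightarrow> C = C'"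
  using enc_nat_prefix_free[of "out_wire C" "[]" "out_wire C'" "[]"]
  by (cases C; cases C')
    (auto simp: enc_circuit_def enc_nat_prefix_free enc_list_prefix_free enc_gate_prefix_free)

lemma concat_enc_nat_prefix_free:
  "length xs = length ys \<Longrightarrow>
   concat (map enc_nat xs) @ u = concat (map enc_nat ys) @ v \<longleftrightarrow> xs = ys \<and> u = v"
  by (induction xs ys rule: list_induct2) (auto simp: enc_nat_prefix_free)

lemma concat_rows_inject:
  "concat (map (\<lambda>i. map (\<lambda>x. x \<in> s i) [0..<n]) is) @ u =
   concat (map (\<lambda>i. map (\<lambda>x. x \<in> s' i) [0..<n]) is) @ v \<longleftrightarrow>
   (\<forall>i\<in>set is. \<forall>x<n. x \<in> s i \<longleftrightarrow> x \<in> s' i) \<and> u = v"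
  by (induction "is") auto

lemma enc_instance_inject:
  "enc_instance n m s \<tau> f = enc_instance n' m' s' \<tau>' f' \<longleftrightarrow>
     n = n' \<and> m = m' \<and> (\<forall>i<m. \<forall>x<n. x \<in> s i \<longleftrightarrow> x \<in> s' i) \<and>
     (\<forall>x<n. \<tau> x = \<tau>' x) \<and> (\<forall>x<n. f x = f' x)"
proof -
  have *: "concat (map (\<lambda>x. enc_nat (a x)) [0..<N]) @ u =
      concat (map (\<lambda>x. enc_nat (b x)) [0..<N]) @ v \<longleftrightarrow> (\<forall>x<N. a x = b x) \<and> u = v"
    for a b :: "nat \<Rightarrow> nat" and u v and N
    using concat_enc_nat_prefix_free[of "map a [0..<N]" "map b [0..<N]" u v]
    by (auto simp: comp_def)
  have **: "concat (map (\<lambda>x. enc_nat (a x)) [0..<N]) =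
      concat (map (\<lambda>x. enc_nat (b x)) [0..<N]) \<longleftrightarrow> (\<forall>x<N. a x = b x)"
    for a b :: "nat \<Rightarrow> nat" and N
    using *[of a N "[]" b "[]"] by simp
  show ?thesis
  proof (cases "n = n' \<and> m = m'")
    case True
    then show ?thesis
      by (auto simp: enc_instance_def enc_nat_prefix_free concat_rows_inject * ** simp del: concat_append)
  qed (auto simp: enc_instance_def enc_nat_prefix_free)
qed

end

theory Submission
  imports Defs
begin

text \<open>
  Let \<open>F\<close> be the support of \<open>f\<close>.  A minimal Roman hitting function above \<open>f\<close> assigns to every
  \<open>x \<in> F\<close> an edge \<open>q x\<close> that only \<open>x\<close> takes care of: \<open>q x = \<tau> x\<close> if \<open>x\<close> gets value 1, and an edge
  \<open>q x \<noteq> \<tau> x\<close> containing no other vertex of value 2 if \<open>x\<close> gets value 2.  Conversely, call a vertex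
  eligible if giving it value 2 does not spoil these edges.  An inclusion-minimal set of eligible
  vertices that contains all \<open>x \<in> F\<close> with \<open>q x \<noteq> \<tau> x\<close> and hits all edges outside the range of \<open>\<tau>\<close>
  is the set of twos of a minimal Roman hitting function above \<open>f\<close>; the remaining edges are
  served by ones.  Hence the extension exists iff one can choose \<open>q\<close> such that every edge outside the
  range of \<open>\<tau>\<close> contains an eligible vertex, and this is an and-or-and condition on the
  \<open>card F \<le> \<omega>(f)\<close> variables \<open>(x, q x)\<close> that are set to true.

  The reduction is written in a small functional language whose only loops are bounded sums.
  Its programs compile to random access machines and always run in polynomial time, so no
  explicit time analysis of the reduction is needed.
\<close>

section \<open>Combinatorial characterisation of extendability\<close>

section \<open>Reservations of edges\<close>

text \<open>A further two can harm \<open>f\<close> only by hitting an edge on which a vertex of the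
  support relies, so fixing these edges beforehand removes the interplay between the values.
  Vertices outside the support need no guess: if one of them gets value 2, inclusion-minimality
  leaves it an edge of its own outside the range of \<open>\<tau>\<close>, and an unhit edge inside
  the range can always be served by a one.

  The weft 3 arises as follows. Eligibility is a conjunction over all reservations, covering an edge
  is a disjunction over its vertices, and the output is a conjunction over all edges. The negations
  and the disjunction between value 1 and value 2 have fan-in at most two and do not count.

  The reduction must also answer correctly on words that encode no instance and on parameters that
  differ from the weight. Parsing and validation therefore run on the machine as well, which is why
  a language with a built-in time bound pays off.\<close>

text \<open>The vertices that may receive value 2 once the edges \<open>q x\<close> are reserved for the vertices \<open>x \<in> F\<close>.\<close>

definition eligible ::
    "('a, 'i) hypergraph \<Rightarrow> ('a \<Rightarrow> 'i) \<Rightarrow> 'a set \<Rightarrow> ('a \<Rightarrow> 'i) \<Rightarrow> 'a \<Rightarrow> bool" where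
  "eligible H \<tau> F q y \<longleftrightarrow>
     (\<forall>x\<in>F. x \<noteq> y \<longrightarrow> y \<notin> edge H (q x)) \<and> (y \<in> F \<longrightarrow> q y \<noteq> \<tau> y)"

text \<open>The second conjunct lets every support vertex get value 2 or keep value 1. In the latter
  case no separate clause forbids a two in \<open>\<tau> y\<close>: as
  \<open>q y = \<tau> y\<close>, eligibility already excludes every vertex of this edge.\<close>

definition reservation ::
    "('a, 'i) hypergraph \<Rightarrow> ('a \<Rightarrow> 'i) \<Rightarrow> ('a \<Rightarrow> nat) \<Rightarrow> 'a set \<Rightarrow> ('a \<Rightarrow> 'i) \<Rightarrow> bool" where
  "reservation H \<tau> f F q \<longleftrightarrow>
     (\<forall>x\<in>F. q x \<in> idx H \<and> x \<in> edge H (q x) \<and> (f x = 2 \<longrightarrow> q x \<noteq> \<tau> x)) \<and>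
     (\<forall>y\<in>F. eligible H \<tau> F q y \<or> q y = \<tau> y \<and> (\<forall>x\<in>F. x \<noteq> y \<longrightarrow> q x \<noteq> \<tau> y)) \<and>
     (\<forall>i\<in>idx H. i \<notin> \<tau> ` verts H \<longrightarrow> (\<exists>y\<in>edge H i. eligible H \<tau> F q y))"

text \<open>A one at \<open>x\<close> serves only the edge \<open>\<tau> x\<close>. If something
  else serves this edge too, then lowering \<open>x\<close> to 0 contradicts minimality.\<close>

lemma minimal_rhf_one:
  assumes "minimal_rhf H \<tau> g" and x: "x \<in> verts H" "g x = 1"
  shows "\<forall>y\<in>edge H (\<tau> x). g y \<noteq> 2"
    and "\<forall>z\<in>verts H. z \<noteq> x \<longrightarrow> \<tau> z = \<tau> x \<longrightarrow> g z \<noteq> 1"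
proof -
  have g: "rhf H \<tau> g" and min: "\<And>h. rhf H \<tau> h \<Longrightarrow> fun_le H h g \<Longrightarrow> h x = g x"
    using assms by (auto simp: minimal_rhf_def)
  have "(\<forall>y\<in>edge H (\<tau> x). g y \<noteq> 2) \<and> (\<forall>z\<in>verts H. z \<noteq> x \<longrightarrow> \<tau> z = \<tau> x \<longrightarrow> g z \<noteq> 1)"
  proof (rule ccontr)
    assume *: "\<not> ?thesis"
    have "rhf H \<tau> (g(x := 0))"
      unfolding rhf_def
    proof (intro conjI ballI)
      show "g(x := 0) \<in> verts H \<rightarrow> {0, 1, 2}" using g by (auto simp: rhf_def Pi_iff)
      fix i assume "i \<in> idx H"
      show "(\<exists>y\<in>edge H i. (g(x := 0)) y = 2) \<or> (\<exists>z\<in>verts H. \<tau> z = i \<and> (g(x := 0)) z = 1)"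
      proof (cases "i = \<tau> x")
        case True
        from * consider y where "y \<in> edge H (\<tau> x)" "g y = 2"
          | z where "z \<in> verts H" "z \<noteq> x" "\<tau> z = \<tau> x" "g z = 1" by blast
        then show ?thesis
        proof cases
          case 1
          then have "(g(x := 0)) y = 2" using x by auto
          then show ?thesis using 1 True by blast
        next
          case 2
          then have "(g(x := 0)) z = 1" by auto
          then show ?thesis using 2 True by blast
        qed
      next
        case False
        then have "(\<exists>y\<in>edge H i. g y = 2) \<or> (\<exists>z\<in>verts H. \<tau> z = i \<and> g z = 1)"
          using g \<open>i \<in> idx H\<close> by (auto simp: rhf_def)
        then show ?thesis
        proof (elim disjE bexE conjE)
          fix y assume y: "y \<in> edge H i" "g y = 2"
          then have "(g(x := 0)) y = 2" using x by auto
          then show ?thesis using y by blast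
        next
          fix z assume z: "z \<in> verts H" "\<tau> z = i" "g z = 1"
          then have "(g(x := 0)) z = 1" using False by auto
          then show ?thesis using z by blast
        qed
      qed
    qed
    moreover have "fun_le H (g(x := 0)) g" by (simp add: fun_le_def)
    ultimately have "(g(x := 0)) x = g x" by (rule min)
    then show False using x by simp
  qed
  then show "\<forall>y\<in>edge H (\<tau> x). g y \<noteq> 2"
    "\<forall>z\<in>verts H. z \<noteq> x \<longrightarrow> \<tau> z = \<tau> x \<longrightarrow> g z \<noteq> 1" by auto
qed

text \<open>Otherwise \<open>x\<close> can be lowered to 1: each edge at \<open>x\<close> other than
  \<open>\<tau> x\<close> is hit by another two, and \<open>\<tau> x\<close> is served by the new
  one.\<close>

lemma minimal_rhf_two:
  assumes "minimal_rhf H \<tau> g" and x: "x \<in> verts H" "g x = 2"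
  shows "\<exists>i\<in>idx H. x \<in> edge H i \<and> i \<noteq> \<tau> x \<and> (\<forall>y\<in>edge H i. y \<noteq> x \<longrightarrow> g y \<noteq> 2)"
proof (rule ccontr)
  assume *: "\<not> ?thesis"
  have g: "rhf H \<tau> g" and min: "\<And>h. rhf H \<tau> h \<Longrightarrow> fun_le H h g \<Longrightarrow> h x = g x"
    using assms by (auto simp: minimal_rhf_def)
  have "rhf H \<tau> (g(x := 1))"
    unfolding rhf_def
  proof (intro conjI ballI)
    show "g(x := 1) \<in> verts H \<rightarrow> {0, 1, 2}" using g by (auto simp: rhf_def Pi_iff)
    fix i assume i: "i \<in> idx H"
    then have "(\<exists>y\<in>edge H i. g y = 2) \<or> (\<exists>z\<in>verts H. \<tau> z = i \<and> g z = 1)"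
      using g by (auto simp: rhf_def)
    then show "(\<exists>y\<in>edge H i. (g(x := 1)) y = 2) \<or> (\<exists>z\<in>verts H. \<tau> z = i \<and> (g(x := 1)) z = 1)"
    proof
      assume "\<exists>y\<in>edge H i. g y = 2"
      then obtain y where y: "y \<in> edge H i" "g y = 2" by blast
      show ?thesis
      proof (cases "\<exists>z\<in>edge H i. z \<noteq> x \<and> g z = 2")
        case True
        then show ?thesis by auto
      next
        case False
        then have "y = x" using y by blast
        then have "\<tau> x = i" using * i y(1) False by blast
        then have "\<tau> x = i \<and> (g(x := 1)) x = 1" by simp
        then show ?thesis using x(1) by blast
      qed
    next
      assume "\<exists>z\<in>verts H. \<tau> z = i \<and> g z = 1"
      then obtain z where z: "z \<in> verts H" "\<tau> z = i" "g z = 1" by blast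
      then have "(g(x := 1)) z = 1" by simp
      then show ?thesis using z by blast
    qed
  qed
  moreover have "fun_le H (g(x := 1)) g" using x by (simp add: fun_le_def)
  ultimately have "(g(x := 1)) x = g x" by (rule min)
  then show False using x by simp
qed

text \<open>Reserve the private edge of a two and \<open>\<tau> x\<close> for a one. No reserved
  edge contains a two of another vertex, so all twos of \<open>g\<close> are eligible; and edges
  outside the range of \<open>\<tau>\<close> can only be hit by twos.\<close>

lemma minimal_rhf_imp_reservation:
  assumes H: "is_hypergraph H" and \<tau>: "correspondence H \<tau>"
    and g: "minimal_rhf H \<tau> g" "fun_le H f g"
    and F: "F = {x \<in> verts H. f x \<noteq> 0}"
  shows "\<exists>q. reservation H \<tau> f F q"
proof -
  have rhf: "rhf H \<tau> g" using g by (simp add: minimal_rhf_def)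
  have vals: "g x = 0 \<or> g x = 1 \<or> g x = 2" if "x \<in> verts H" for x
    using rhf that by (auto simp: rhf_def Pi_iff)
  obtain p where p: "\<And>x. x \<in> verts H \<Longrightarrow> g x = 2 \<Longrightarrow> p x \<in> idx H \<and> x \<in> edge H (p x) \<and> p x \<noteq> \<tau> x \<and>
      (\<forall>y\<in>edge H (p x). y \<noteq> x \<longrightarrow> g y \<noteq> 2)"
    using minimal_rhf_two[OF g(1)] by metis
  define q where "q x = (if g x = 2 then p x else \<tau> x)" for x
  have gF: "g x = 1 \<or> g x = 2" if "x \<in> F" for x
    using vals[of x] that g(2) by (auto simp: F fun_le_def)
  have FV: "F \<subseteq> verts H" by (auto simp: F)
  have \<tau>': "\<tau> x \<in> idx H" "x \<in> edge H (\<tau> x)" if "x \<in> verts H" for x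
    using \<tau> that by (auto simp: correspondence_def)
  have el: "eligible H \<tau> F q y" if "y \<in> verts H" "g y = 2" for y
    unfolding eligible_def
  proof (intro conjI ballI impI)
    fix x assume "x \<in> F" "x \<noteq> y"
    then show "y \<notin> edge H (q x)"
      using gF[of x] p[of x] minimal_rhf_one(1)[OF g(1), of x] FV that by (auto simp: q_def)
  next
    assume "y \<in> F"
    then show "q y \<noteq> \<tau> y" using p[OF that] that by (simp add: q_def)
  qed
  have "reservation H \<tau> f F q"
    unfolding reservation_def
  proof (intro conjI ballI impI)
    fix x assume x: "x \<in> F"
    show "q x \<in> idx H" "x \<in> edge H (q x)" using x FV gF[of x] p[of x] \<tau>'[of x] by (auto simp: q_def)
    assume "f x = 2"
    then have "g x = 2" using gF[OF x] g(2) x by (auto simp: fun_le_def F)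
    then show "q x \<noteq> \<tau> x" using p[of x] x FV by (auto simp: q_def)
  next
    fix y assume y: "y \<in> F"
    show "eligible H \<tau> F q y \<or> q y = \<tau> y \<and> (\<forall>x\<in>F. x \<noteq> y \<longrightarrow> q x \<noteq> \<tau> y)"
    proof (cases "g y = 2")
      case True
      then show ?thesis using el y FV by auto
    next
      case False
      then have gy: "g y = 1" using gF[OF y] by simp
      have "q x \<noteq> \<tau> y" if "x \<in> F" "x \<noteq> y" for x
      proof (cases "g x = 2")
        case True
        have "x \<in> verts H" "y \<in> verts H" using that y FV by auto
        then have "x \<in> edge H (q x)" "x \<notin> edge H (\<tau> y)"
          using p[of x] minimal_rhf_one(1)[OF g(1) _ gy] True by (auto simp: q_def)
        then show ?thesis by auto
      next
        case False
        then have "g x = 1" using gF[OF that(1)] by simp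
        then show ?thesis using minimal_rhf_one(2)[OF g(1) _ gy] that y FV by (auto simp: q_def)
      qed
      then show ?thesis using gy by (auto simp: q_def)
    qed
  next
    fix i assume i: "i \<in> idx H" "i \<notin> \<tau> ` verts H"
    then obtain y where "y \<in> edge H i" "g y = 2" using rhf by (auto simp: rhf_def)
    moreover have "y \<in> verts H" using H i(1) \<open>y \<in> edge H i\<close> by (auto simp: is_hypergraph_def)
    ultimately show "\<exists>y\<in>edge H i. eligible H \<tau> F q y" using el by auto
  qed
  then show ?thesis by blast
qed

text \<open>The constructed function is minimal because nothing can be lowered: a one is the only
  server of an unhit edge, and a two owns an edge other than \<open>\<tau> x\<close>, so it can drop
  neither to 0 nor to 1.\<close>

lemma reservation_imp_extension:
  assumes H: "is_hypergraph H" and \<tau>: "correspondence H \<tau>"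
    and f: "f \<in> verts H \<rightarrow> {0, 1, 2}"
    and F: "F = {x \<in> verts H. f x \<noteq> 0}"
    and q: "reservation H \<tau> f F q"
  shows "extension_rhf_yes H \<tau> f"
proof -
  have fin: "finite (verts H)" and sub: "\<And>i. i \<in> idx H \<Longrightarrow> edge H i \<subseteq> verts H"
    using H by (auto simp: is_hypergraph_def)
  have \<tau>': "\<tau> x \<in> idx H" "x \<in> edge H (\<tau> x)" if "x \<in> verts H" for x
    using \<tau> that by (auto simp: correspondence_def)
  have FV: "F \<subseteq> verts H" by (auto simp: F)
  let ?el = "eligible H \<tau> F q"
  define bad where "bad = {i \<in> idx H. i \<notin> \<tau> ` verts H}"
  define D0 where "D0 = {y \<in> F. q y \<noteq> \<tau> y}"
  define hits where "hits D \<longleftrightarrow> D0 \<subseteq> D \<and> D \<subseteq> {y \<in> verts H. ?el y} \<and> (\<forall>i\<in>bad. \<exists>y\<in>edge H i. y \<in> D)" for D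
  have D0: "D0 \<subseteq> {y \<in> verts H. ?el y}"
    using q FV by (auto simp: D0_def reservation_def)
  have "hits {y \<in> verts H. ?el y}"
    unfolding hits_def
  proof (intro conjI ballI)
    fix i assume "i \<in> bad"
    then obtain y where "y \<in> edge H i" "?el y" using q by (auto simp: bad_def reservation_def)
    then show "\<exists>y\<in>edge H i. y \<in> {y \<in> verts H. ?el y}" using sub[of i] \<open>i \<in> bad\<close> by (auto simp: bad_def)
  qed (use D0 in auto)
  moreover have "finite {D. hits D}"
    by (rule finite_subset[of _ "Pow (verts H)"]) (use fin in \<open>auto simp: hits_def\<close>)
  ultimately obtain D where D: "hits D" and Dmin: "\<And>D'. hits D' \<Longrightarrow> D' \<subseteq> D \<Longrightarrow> D' = D"
    using finite_has_minimal[of "{D. hits D}"] by (metis (mono_tags, lifting) empty_iff mem_Collect_eq)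
  have DV: "D \<subseteq> verts H" and Del: "\<And>y. y \<in> D \<Longrightarrow> ?el y" using D by (auto simp: hits_def)
  \<comment> \<open>A vertex of \<open>D0\<close> owns its reserved edge, since the other members of
    \<open>D\<close> are eligible. Any other \<open>x\<close> owes its place in \<open>D\<close> to
    minimality: without it some edge of \<open>bad\<close> is no longer hit, and such an edge
    differs from \<open>\<tau> x\<close>.\<close>
  have priv: "\<exists>i\<in>idx H. x \<in> edge H i \<and> i \<noteq> \<tau> x \<and> (\<forall>y\<in>edge H i. y \<in> D \<longrightarrow> y = x)" if x: "x \<in> D" for x
  proof (cases "x \<in> D0")
    case True
    then have "x \<in> F" "q x \<noteq> \<tau> x" by (auto simp: D0_def)
    moreover have "y = x" if "y \<in> edge H (q x)" "y \<in> D" for y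
      using Del[OF that(2)] that(1) \<open>x \<in> F\<close> by (auto simp: eligible_def)
    ultimately show ?thesis using q by (auto simp: reservation_def)
  next
    case False
    then have "\<not> hits (D - {x})" using Dmin[of "D - {x}"] x by blast
    then obtain i where i: "i \<in> bad" "\<forall>y\<in>edge H i. y \<notin> D - {x}"
      using D False by (auto simp: hits_def)
    moreover obtain y where "y \<in> edge H i" "y \<in> D" using D i(1) by (auto simp: hits_def)
    ultimately have "x \<in> edge H i" by auto
    moreover have "i \<noteq> \<tau> x" using i(1) x DV by (auto simp: bad_def)
    ultimately show ?thesis using i by (auto simp: bad_def)
  qed
  define unhit where "unhit i \<longleftrightarrow> i \<in> idx H \<and> (\<forall>y\<in>edge H i. y \<notin> D)" for i
  have F1: "q x = \<tau> x" "unhit (\<tau> x)" "x \<notin> D" if x: "x \<in> F - D0" for x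
  proof -
    show qx: "q x = \<tau> x" using x by (simp add: D0_def)
    then show xD: "x \<notin> D" using Del[of x] x by (auto simp: eligible_def)
    have "y \<notin> D" if "y \<in> edge H (\<tau> x)" for y
    proof
      assume "y \<in> D"
      then show False using Del[of y] that x xD qx by (auto simp: eligible_def)
    qed
    then show "unhit (\<tau> x)" using \<tau>'(1)[of x] x FV by (auto simp: unhit_def)
  qed
  have uniq: "x = z" if "x \<in> F - D0" "z \<in> F - D0" "\<tau> x = \<tau> z" for x z
  proof (rule ccontr)
    assume "x \<noteq> z"
    have "\<not> ?el z" using F1(1)[OF that(2)] that(2) by (auto simp: eligible_def)
    then have "q x \<noteq> \<tau> z" using q that \<open>x \<noteq> z\<close> by (auto simp: reservation_def)
    then show False using F1(1)[OF that(1)] that(3) by simp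
  qed
  \<comment> \<open>Among the vertices that can serve edge \<open>i\<close> by a one, those of
    \<open>F - D0\<close> are preferred, because \<open>f\<close> does not allow them the value
    0.\<close>
  define r where "r i = (if \<exists>x\<in>F - D0. \<tau> x = i then SOME x. x \<in> F - D0 \<and> \<tau> x = i
     else SOME x. x \<in> verts H \<and> \<tau> x = i)" for i
  have r: "r i \<in> verts H \<and> \<tau> (r i) = i" if "unhit i" for i
  proof (cases "\<exists>x\<in>F - D0. \<tau> x = i")
    case True
    then have "\<exists>x. x \<in> F - D0 \<and> \<tau> x = i" by blast
    from someI_ex[OF this] True have "r i \<in> F - D0 \<and> \<tau> (r i) = i" by (simp only: r_def if_True)
    then show ?thesis using FV by auto
  next
    case False
    have "i \<notin> bad" using that D by (auto simp: unhit_def hits_def)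
    then have "\<exists>x. x \<in> verts H \<and> \<tau> x = i" using that by (auto simp: bad_def unhit_def)
    from someI_ex[OF this] False show ?thesis by (simp only: r_def if_False)
  qed
  have rF: "r (\<tau> x) = x" if "x \<in> F - D0" for x
  proof -
    have "\<exists>z. z \<in> F - D0 \<and> \<tau> z = \<tau> x" using that by blast
    then have "(SOME z. z \<in> F - D0 \<and> \<tau> z = \<tau> x) = x"
      using that uniq by (intro some_equality) auto
    then show ?thesis using that unfolding r_def by auto
  qed
  define g where "g x = (if x \<in> D then 2 else if unhit (\<tau> x) \<and> r (\<tau> x) = x then 1 else 0 :: nat)" for x
  have g2: "g x = 2 \<longleftrightarrow> x \<in> D" for x by (simp add: g_def)
  have g1: "unhit (\<tau> x) \<and> r (\<tau> x) = x" if "g x = 1" for x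
    using that by (auto simp: g_def split: if_splits)
  have rhf_g: "rhf H \<tau> g"
    unfolding rhf_def
  proof (intro conjI ballI)
    show "g \<in> verts H \<rightarrow> {0, 1, 2}" by (auto simp: g_def)
    fix i assume i: "i \<in> idx H"
    show "(\<exists>x\<in>edge H i. g x = 2) \<or> (\<exists>x\<in>verts H. \<tau> x = i \<and> g x = 1)"
    proof (cases "unhit i")
      case True
      then have "r i \<in> verts H" "\<tau> (r i) = i" using r by auto
      moreover from this have "r i \<notin> D" using True \<tau>'(2)[of "r i"] by (auto simp: unhit_def)
      ultimately have "g (r i) = 1" using True by (simp add: g_def)
      then show ?thesis using \<open>r i \<in> verts H\<close> \<open>\<tau> (r i) = i\<close> by blast
    qed (use i in \<open>auto simp: g2 unhit_def\<close>)
  qed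
  have "h x = g x" if h: "rhf H \<tau> h" "fun_le H h g" and x: "x \<in> verts H" for h x
  proof -
    have hx: "h y \<le> g y" if "y \<in> verts H" for y using h(2) that by (simp add: fun_le_def)
    have h2: "y \<in> D" if "y \<in> verts H" "h y = 2" for y
      using hx[OF that(1)] that(2) g2[of y] by (auto simp: g_def split: if_splits)
    have hit: "(\<exists>y\<in>edge H i. h y = 2) \<or> (\<exists>z\<in>verts H. \<tau> z = i \<and> h z = 1)" if "i \<in> idx H" for i
      using h(1) that by (simp add: rhf_def)
    have "g x = 0 \<or> g x = 1 \<or> x \<in> D" by (simp add: g_def)
    then show ?thesis
    proof (elim disjE)
      assume "g x = 0"
      then show ?thesis using hx[OF x] by simp
    next
      assume gx: "g x = 1"
      then have u: "unhit (\<tau> x)" "r (\<tau> x) = x" using g1 by auto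
      then have "\<not> (\<exists>y\<in>edge H (\<tau> x). h y = 2)" using h2 sub by (auto simp: unhit_def)
      then obtain z where z: "z \<in> verts H" "\<tau> z = \<tau> x" "h z = 1" using hit[of "\<tau> x"] \<tau>'(1)[OF x] by auto
      have "z \<notin> D" using u(1) \<tau>'(2)[OF z(1)] z(2) by (auto simp: unhit_def)
      then have "g z = 1" using hx[OF z(1)] z(3) by (auto simp: g_def split: if_splits)
      then have "z = x" using g1[of z] z(2) u(2) by simp
      then show ?thesis using gx z(3) by simp
    next
      assume xD: "x \<in> D"
      obtain i where i: "i \<in> idx H" "x \<in> edge H i" "i \<noteq> \<tau> x" "\<forall>y\<in>edge H i. y \<in> D \<longrightarrow> y = x"
        using priv[OF xD] by blast
      from hit[OF i(1)] show ?thesis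
      proof
        assume "\<exists>y\<in>edge H i. h y = 2"
        then obtain y where "y \<in> edge H i" "h y = 2" by blast
        then have "y = x" using h2[of y] i sub by auto
        then show ?thesis using \<open>h y = 2\<close> xD g2 by simp
      next
        \<comment> \<open>A one of \<open>h\<close> at \<open>z\<close> cannot serve the private
          edge \<open>i\<close> of \<open>x\<close>. As \<open>i\<close> is hit, \<open>g z\<close>
          is positive only for \<open>z\<close> in \<open>D\<close>; then privacy gives
          \<open>z = x\<close>, contrary to \<open>i \<noteq> \<tau> x\<close>.\<close>
        assume "\<exists>z\<in>verts H. \<tau> z = i \<and> h z = 1"
        then obtain z where z: "z \<in> verts H" "\<tau> z = i" "h z = 1" by blast
        have "\<not> unhit i" using i(2) xD by (auto simp: unhit_def)
        then have "z \<in> D" using hx[OF z(1)] z(2,3) by (auto simp: g_def split: if_splits)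
        then have "z = x" using i(4) \<tau>'(2)[OF z(1)] z(2) by auto
        then show ?thesis using i(3) z(2) by simp
      qed
    qed
  qed
  then have "minimal_rhf H \<tau> g" using rhf_g by (auto simp: minimal_rhf_def)
  moreover have "f x \<le> g x" if x: "x \<in> verts H" for x
  proof (cases "x \<in> F")
    case True
    show ?thesis
    proof (cases "x \<in> D0")
      case True
      then have "g x = 2" using D by (auto simp: g2 hits_def)
      moreover have "f x \<in> {0, 1, 2}" using f x by blast
      ultimately show ?thesis by auto
    next
      case False
      then have xF: "x \<in> F - D0" using True by simp
      then have "g x = 1" using F1[OF xF] rF[OF xF] by (simp add: g_def)
      moreover have "f x \<noteq> 2" using q F1(1)[OF xF] True by (auto simp: reservation_def)
      moreover have "f x \<in> {0, 1, 2}" using f x by blast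
      ultimately show ?thesis by auto
    qed
  qed (use x in \<open>simp add: F\<close>)
  ultimately show ?thesis by (auto simp: extension_rhf_yes_def fun_le_def)
qed

theorem extension_rhf_yes_iff_reservation:
  assumes "is_hypergraph H" "correspondence H \<tau>" "f \<in> verts H \<rightarrow> {0, 1, 2}"
  shows "extension_rhf_yes H \<tau> f \<longleftrightarrow> (\<exists>q. reservation H \<tau> f {x \<in> verts H. f x \<noteq> 0} q)"
  using minimal_rhf_imp_reservation[OF assms(1,2)] reservation_imp_extension[OF assms]
  unfolding extension_rhf_yes_def by blast

section \<open>Values of wires and potentials along paths\<close>

section \<open>Evaluation of circuits\<close>

lemma gate_val_cong:
  "(\<And>u. u \<in> set (fanin g) \<Longrightarrow> vs ! u = ws ! u) \<Longrightarrow> gate_val vs g = gate_val ws g"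
  by (cases g) auto

text \<open>Appending values never changes earlier ones, and fan-ins point strictly backwards. So
  each gate may be evaluated on the final list of values instead of the prefix present when it was
  processed.\<close>

lemma foldl_gate_val:
  defines "F \<equiv> foldl (\<lambda>vs g. vs @ [gate_val vs g])"
  shows "length (F vs gs) = length vs + length gs"
    and "u < length vs \<Longrightarrow> F vs gs ! u = vs ! u"
    and "(\<And>j u. j < length gs \<Longrightarrow> u \<in> set (fanin (gs ! j)) \<Longrightarrow> u < length vs + j) \<Longrightarrow>
      j < length gs \<Longrightarrow> F vs gs ! (length vs + j) = gate_val (F vs gs) (gs ! j)"
proof -
  show len: "length (F vs gs) = length vs + length gs" for gs
    by (induction gs rule: rev_induct) (simp_all add: F_def)
  have snoc: "F vs (gs @ [g]) = F vs gs @ [gate_val (F vs gs) g]" for gs g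
    by (simp add: F_def)
  show "u < length vs \<Longrightarrow> F vs gs ! u = vs ! u"
    by (induction gs rule: rev_induct) (simp add: F_def, simp add: snoc nth_append len)
  show "(\<And>j u. j < length gs \<Longrightarrow> u \<in> set (fanin (gs ! j)) \<Longrightarrow> u < length vs + j) \<Longrightarrow>
      j < length gs \<Longrightarrow> F vs gs ! (length vs + j) = gate_val (F vs gs) (gs ! j)"
  proof (induction gs rule: rev_induct)
    case (snoc g gs)
    have fan: "u < length vs + i" if "i < length gs" "u \<in> set (fanin (gs ! i))" for i u
      using snoc.prems(1)[of i u] that by (simp add: nth_append)
    have fang: "u < length vs + length gs" if "u \<in> set (fanin g)" for u
      using snoc.prems(1)[of "length gs" u] that by simp
    have ext: "gate_val (F vs (gs @ [g])) h = gate_val (F vs gs) h"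
      if "\<And>u. u \<in> set (fanin h) \<Longrightarrow> u < length vs + length gs" for h
      by (rule gate_val_cong) (simp add: \<open>\<And>gs g. F vs (gs @ [g]) = _\<close> nth_append len that)
    show ?case
    proof (cases "j = length gs")
      case True
      then show ?thesis using ext[OF fang]
        by (simp add: \<open>\<And>gs g. F vs (gs @ [g]) = _\<close> nth_append len)
    next
      case False
      then have j: "j < length gs" using snoc.prems(2) by simp
      have "F vs gs ! (length vs + j) = gate_val (F vs gs) (gs ! j)"
        using fan j by (intro snoc.IH)
      moreover have "gate_val (F vs (gs @ [g])) (gs ! j) = gate_val (F vs gs) (gs ! j)"
        using fan[OF j] j by (intro ext) fastforce
      ultimately show ?thesis
        using j by (simp add: \<open>\<And>gs g. F vs (gs @ [g]) = _\<close> nth_append len)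
    qed
  qed simp
qed

lemma wire_vals_input: "i < inputs C \<Longrightarrow> wire_vals C S ! i \<longleftrightarrow> i \<in> S"
  unfolding wire_vals_def by (subst foldl_gate_val(2)) simp_all

lemma wire_vals_gate:
  assumes "wf_circuit C" "is_gate C w"
  shows "wire_vals C S ! w = gate_val (wire_vals C S) (gate_at C w)"
proof -
  obtain j where j: "w = inputs C + j" "j < length (gates C)"
    using assms(2) by (metis is_gate_def add_less_cancel_left le_Suc_ex)
  then show ?thesis
    using assms(1) foldl_gate_val(3)[of "gates C" "map (\<lambda>i. i \<in> S) [0..<inputs C]" j]
    unfolding wire_vals_def wf_circuit_def gate_at_def by auto
qed

text \<open>A potential argument: \<open>r\<close> never falls along a wire and rises at each
  counted gate. It serves for the depth, with all gates counted, and for the weft, with the large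
  gates counted.\<close>

lemma length_filter_path_le:
  assumes P: "\<And>w. P w \<Longrightarrow> 1 \<le> r w" and feeds: "\<And>u w. feeds C u w \<Longrightarrow> r u + of_bool (P w) \<le> r w"
  shows "successively (feeds C) ws \<Longrightarrow> ws \<noteq> [] \<Longrightarrow> length (filter P ws) \<le> (r (last ws) :: nat)"
proof (induction ws rule: rev_induct)
  case (snoc w ws)
  show ?case
  proof (cases "ws = []")
    case True
    then show ?thesis using P[of w] by simp
  next
    case False
    then have "length (filter P ws) \<le> r (last ws)" "feeds C (last ws) w"
      using snoc by (auto simp: successively_append_iff)
    then show ?thesis using feeds[of "last ws" w] by (cases "P w") auto
  qed
qed simp

section \<open>A circuit of weft 3 that checks a reservation\<close>

section \<open>The circuit\<close>

text \<open>
  Input \<open>x * m + j\<close> says \<open>q x = j\<close>, and wire \<open>n * m + (x * m + j)\<close> is its negation.  The five lists are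
  the fan-ins of the gates for: \<open>y\<close> is eligible; \<open>q y = \<tau> y\<close> and no other vertex reserves \<open>\<tau> y\<close>;
  \<open>y\<close> reserves an admissible edge; edge \<open>i\<close> contains an eligible vertex; the output.  Uniqueness of
  the reserved edge is not tested, since it follows from the weight of the assignment.
\<close>

definition conflict_list :: "nat \<Rightarrow> nat \<Rightarrow> (nat \<Rightarrow> nat set) \<Rightarrow> (nat \<Rightarrow> nat) \<Rightarrow> nat \<Rightarrow> nat list" where
  "conflict_list n m s \<tau> y = concat (map (\<lambda>x. concat (map (\<lambda>j.
     if x \<noteq> y \<and> y \<in> s j \<or> x = y \<and> j = \<tau> y then [n * m + (x * m + j)] else []) [0..<m])) [0..<n])"

definition keep_one_list :: "nat \<Rightarrow> nat \<Rightarrow> (nat \<Rightarrow> nat) \<Rightarrow> nat \<Rightarrow> nat list" where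
  "keep_one_list n m \<tau> y = concat (map (\<lambda>x. concat (map (\<lambda>j.
     if j = \<tau> y then [if x = y then x * m + j else n * m + (x * m + j)] else []) [0..<m])) [0..<n])"

definition choice_list ::
    "nat \<Rightarrow> (nat \<Rightarrow> nat set) \<Rightarrow> (nat \<Rightarrow> nat) \<Rightarrow> (nat \<Rightarrow> nat) \<Rightarrow> nat \<Rightarrow> nat list" where
  "choice_list m s \<tau> f y = concat (map (\<lambda>j.
     if y \<in> s j \<and> \<not> (f y = 2 \<and> j = \<tau> y) then [y * m + j] else []) [0..<m])"

definition cover_list :: "nat \<Rightarrow> nat \<Rightarrow> (nat \<Rightarrow> nat set) \<Rightarrow> nat \<Rightarrow> nat list" where
  "cover_list n m s i = concat (map (\<lambda>y. if y \<in> s i then [2 * (n * m) + y] else []) [0..<n])"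

definition output_list :: "nat \<Rightarrow> nat \<Rightarrow> (nat \<Rightarrow> nat) \<Rightarrow> (nat \<Rightarrow> nat) \<Rightarrow> nat list" where
  "output_list n m \<tau> f =
     concat (map (\<lambda>y. if f y \<noteq> 0 then [2 * (n * m) + 2 * n + y] else []) [0..<n]) @
     concat (map (\<lambda>y. if f y \<noteq> 0 then [2 * (n * m) + 3 * n + y] else []) [0..<n]) @
     concat (map (\<lambda>i. if i \<in> \<tau> ` {..<n} then [] else [2 * (n * m) + 4 * n + i]) [0..<m])"

text \<open>After the inputs and their negations, four blocks of \<open>n\<close> wires start at
  \<open>2 * (n * m)\<close>; the block of the \<open>m\<close> covering gates and the output
  follow. The disjunction between value 2 and value 1 is given fan-in two so that it does not add to
  the weft.\<close>

definition extension_circuit ::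
    "nat \<Rightarrow> nat \<Rightarrow> (nat \<Rightarrow> nat set) \<Rightarrow> (nat \<Rightarrow> nat) \<Rightarrow> (nat \<Rightarrow> nat) \<Rightarrow> circuit" where
  "extension_circuit n m s \<tau> f = Circuit (n * m)
     (map Not_gate [0..<n * m] @
      map (\<lambda>y. And_gate (conflict_list n m s \<tau> y)) [0..<n] @
      map (\<lambda>y. And_gate (keep_one_list n m \<tau> y)) [0..<n] @
      map (\<lambda>y. Or_gate [2 * (n * m) + y, 2 * (n * m) + n + y]) [0..<n] @
      map (\<lambda>y. Or_gate (choice_list m s \<tau> f y)) [0..<n] @
      map (\<lambda>i. Or_gate (cover_list n m s i)) [0..<m] @
      [And_gate (output_list n m \<tau> f)])
     (2 * (n * m) + 4 * n + m)"

lemma pair_index_less: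
  assumes "x < n" "j < (m::nat)"
  shows "x * m + j < n * m"
proof -
  have "x * m + j < Suc x * m" using assms(2) by simp
  also have "\<dots> \<le> n * m" using assms(1) by (intro mult_le_mono1) simp
  finally show ?thesis .
qed

lemma pair_index_inject:
  assumes "j < (m::nat)" "j' < m" "x * m + j = x' * m + j'"
  shows "x = x' \<and> j = j'"
proof -
  have "(x * m + j) div m = x" "(x' * m + j') div m = x'" using assms(1,2) by auto
  then show ?thesis using assms(3) by auto
qed

text \<open>A name for the product \<open>n * m\<close> keeps all wire positions linear in
  \<open>N\<close>, \<open>n\<close> and \<open>m\<close>.\<close>

context
  fixes n m N :: nat and s :: "nat \<Rightarrow> nat set" and \<tau> f :: "nat \<Rightarrow> nat" and C :: circuit
  assumes N: "n * m = N" and C: "C = extension_circuit n m s \<tau> f"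
begin

private lemma inputs_C: "inputs C = N" and out_wire_C: "out_wire C = 2 * N + 4 * n + m"
  and length_gates_C: "length (gates C) = N + 4 * n + m + 1"
  by (simp_all add: C extension_circuit_def N)

private lemma gate_at_C:
  "i < N \<Longrightarrow> gate_at C (N + i) = Not_gate i"
  "y < n \<Longrightarrow> gate_at C (2 * N + y) = And_gate (conflict_list n m s \<tau> y)"
  "y < n \<Longrightarrow> gate_at C (2 * N + n + y) = And_gate (keep_one_list n m \<tau> y)"
  "y < n \<Longrightarrow> gate_at C (2 * N + 2 * n + y) = Or_gate [2 * N + y, 2 * N + n + y]"
  "y < n \<Longrightarrow> gate_at C (2 * N + 3 * n + y) = Or_gate (choice_list m s \<tau> f y)"
  "j < m \<Longrightarrow> gate_at C (2 * N + 4 * n + j) = Or_gate (cover_list n m s j)"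
  "gate_at C (2 * N + 4 * n + m) = And_gate (output_list n m \<tau> f)"
  by (simp_all add: C gate_at_def extension_circuit_def nth_append N)

private lemma gate_cases_C:
  assumes "is_gate C w"
  obtains (not) i where "i < N" "w = N + i"
    | (conflict) y where "y < n" "w = 2 * N + y"
    | (keep) y where "y < n" "w = 2 * N + n + y"
    | (either) y where "y < n" "w = 2 * N + 2 * n + y"
    | (choice) y where "y < n" "w = 2 * N + 3 * n + y"
    | (cover) j where "j < m" "w = 2 * N + 4 * n + j"
    | (out) "w = 2 * N + 4 * n + m"
proof -
  have w: "N \<le> w" "w < 2 * N + 4 * n + m + 1"
    using assms by (auto simp: is_gate_def inputs_C length_gates_C)
  then consider "w < 2 * N" | "2 * N \<le> w" "w < 2 * N + n" | "2 * N + n \<le> w" "w < 2 * N + 2 * n"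
    | "2 * N + 2 * n \<le> w" "w < 2 * N + 3 * n" | "2 * N + 3 * n \<le> w" "w < 2 * N + 4 * n"
    | "2 * N + 4 * n \<le> w" "w < 2 * N + 4 * n + m" | "w = 2 * N + 4 * n + m" by linarith
  then show thesis
  proof cases
    case 1 then show thesis using not[of "w - N"] w by simp
  next
    case 2 then show thesis using conflict[of "w - 2 * N"] by simp
  next
    case 3 then show thesis using keep[of "w - (2 * N + n)"] by simp
  next
    case 4 then show thesis using either[of "w - (2 * N + 2 * n)"] by simp
  next
    case 5 then show thesis using choice[of "w - (2 * N + 3 * n)"] by simp
  next
    case 6 then show thesis using cover[of "w - (2 * N + 4 * n)"] by simp
  qed (fact out)
qed

private lemma set_conflict_list:
  "set (conflict_list n m s \<tau> y) =
     {N + (x * m + j) | x j. x < n \<and> j < m \<and> (x \<noteq> y \<and> y \<in> s j \<or> x = y \<and> j = \<tau> y)}"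
  by (auto simp: conflict_list_def N; blast)

private lemma set_keep_one_list:
  "set (keep_one_list n m \<tau> y) =
     {if x = y then x * m + \<tau> y else N + (x * m + \<tau> y) | x. x < n \<and> \<tau> y < m}"
  by (auto simp: keep_one_list_def N)

private lemma set_choice_list:
  "set (choice_list m s \<tau> f y) = {y * m + j | j. j < m \<and> y \<in> s j \<and> \<not> (f y = 2 \<and> j = \<tau> y)}"
  by (auto simp: choice_list_def)

private lemma set_cover_list: "set (cover_list n m s i) = {2 * N + y | y. y < n \<and> y \<in> s i}"
  by (auto simp: cover_list_def N)

private lemma set_output_list:
  "set (output_list n m \<tau> f) = {2 * N + 2 * n + y | y. y < n \<and> f y \<noteq> 0} \<union>
     {2 * N + 3 * n + y | y. y < n \<and> f y \<noteq> 0} \<union>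
     {2 * N + 4 * n + i | i. i < m \<and> i \<notin> \<tau> ` {..<n}}"
  by (auto simp: output_list_def N split: if_splits)

text \<open>The layer of a wire. It rises strictly along wires, which bounds the depth by 4. Layer 1
  consists of the negations, which are small, so the layer minus one is a potential for the large
  gates and bounds the weft by 3.\<close>

private definition rank :: "nat \<Rightarrow> nat" where
  "rank w = (if w < N then 0 else if w < 2 * N then 1 else if w < 2 * N + 2 * n then 2
     else if w < 2 * N + 4 * n + m then 3 else 4)"

private lemma feeds_C:
  assumes "feeds C u w"
  shows "u < w" "rank u < rank w"
proof -
  have w: "is_gate C w" and u: "u \<in> set (fanin (gate_at C w))" using assms by (auto simp: feeds_def)
  have "u < w \<and> rank u < rank w"
    using w
  proof (cases rule: gate_cases_C)
    case (not i)
    then show ?thesis using u by (simp add: gate_at_C rank_def)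
  next
    case (conflict y)
    then obtain x j where "x < n" "j < m" "u = N + (x * m + j)"
      using u by (auto simp: gate_at_C set_conflict_list)
    then show ?thesis using conflict pair_index_less[of x n j m, unfolded N] by (simp add: rank_def)
  next
    case (keep y)
    then obtain x where "x < n" "\<tau> y < m" "u = x * m + \<tau> y \<or> u = N + (x * m + \<tau> y)"
      using u by (auto simp: gate_at_C set_keep_one_list)
    then show ?thesis using keep pair_index_less[of x n "\<tau> y" m, unfolded N] by (auto simp: rank_def)
  next
    case (either y)
    then show ?thesis using u by (auto simp: gate_at_C rank_def)
  next
    case (choice y)
    then obtain j where "j < m" "u = y * m + j"
      using u by (auto simp: gate_at_C set_choice_list)
    then show ?thesis using choice pair_index_less[of y n j m, unfolded N] by (simp add: rank_def)
  next
    case (cover j)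
    then show ?thesis using u by (auto simp: gate_at_C set_cover_list rank_def)
  next
    case out
    then show ?thesis using u by (auto simp: gate_at_C set_output_list rank_def)
  qed
  then show "u < w" "rank u < rank w" by auto
qed

lemma wf_extension_circuit: "wf_circuit C"
  unfolding wf_circuit_def
proof (intro conjI allI ballI impI)
  show "out_wire C < inputs C + length (gates C)"
    by (simp add: inputs_C out_wire_C length_gates_C)
  fix j u assume "j < length (gates C)" "u \<in> set (fanin (gates C ! j))"
  then have "feeds C u (inputs C + j)" by (simp add: feeds_def is_gate_def gate_at_def)
  then show "u < inputs C + j" by (rule feeds_C)
qed

lemma depth_extension_circuit: "depth_at_most C 4"
  unfolding depth_at_most_def
proof (intro allI impI)
  fix ws assume "path_to_output C ws"
  then have ws: "successively (feeds C) ws" "ws \<noteq> []" by (auto simp: path_to_output_def)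
  have "length (filter (is_gate C) ws) \<le> rank (last ws)"
  proof (rule length_filter_path_le[OF _ _ ws])
    show "1 \<le> rank w" if "is_gate C w" for w
      using that by (auto simp: is_gate_def inputs_C rank_def)
    show "rank u + of_bool (is_gate C w) \<le> rank w" if "feeds C u w" for u w
      using feeds_C(2)[OF that] by (cases "is_gate C w") auto
  qed
  also have "\<dots> \<le> 4" by (simp add: rank_def)
  finally show "length (filter (is_gate C) ws) \<le> 4" .
qed

lemma weft_extension_circuit: "weft_at_most C 3"
  unfolding weft_at_most_def
proof (intro allI impI)
  fix ws assume "path_to_output C ws"
  then have ws: "successively (feeds C) ws" "ws \<noteq> []" by (auto simp: path_to_output_def)
  have large: "2 \<le> rank w" if "large_gate C w" for w
  proof -
    have "is_gate C w" and l: "2 < length (fanin (gate_at C w))" using that by (auto simp: large_gate_def)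
    then show ?thesis
      by (cases rule: gate_cases_C) (auto simp: gate_at_C rank_def)
  qed
  have "length (filter (large_gate C) ws) \<le> rank (last ws) - 1"
  proof (rule length_filter_path_le[OF _ _ ws])
    show "1 \<le> rank w - 1" if "large_gate C w" for w
      using large[OF that] by simp
    show "rank u - 1 + of_bool (large_gate C w) \<le> rank w - 1" if "feeds C u w" for u w
      using feeds_C(2)[OF that] large[of w] by (cases "large_gate C w") auto
  qed
  also have "\<dots> \<le> 3" by (simp add: rank_def)
  finally show "length (filter (large_gate C) ws) \<le> 3" .
qed

text \<open>This holds for arbitrary \<open>S\<close>; that each support vertex chooses a single
  edge enters only through the weight of \<open>S\<close>.\<close>

lemma satisfies_extension_circuit_iff:
  "satisfies C S \<longleftrightarrow>
     (\<forall>y<n. f y \<noteq> 0 \<longrightarrow>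
        (\<forall>x<n. \<forall>j<m. x \<noteq> y \<and> y \<in> s j \<or> x = y \<and> j = \<tau> y \<longrightarrow> x * m + j \<notin> S) \<or>
        (\<forall>x<n. \<tau> y < m \<longrightarrow> (x * m + \<tau> y \<in> S \<longleftrightarrow> x = y))) \<and>
     (\<forall>y<n. f y \<noteq> 0 \<longrightarrow> (\<exists>j<m. y \<in> s j \<and> \<not> (f y = 2 \<and> j = \<tau> y) \<and> y * m + j \<in> S)) \<and>
     (\<forall>i<m. i \<notin> \<tau> ` {..<n} \<longrightarrow> (\<exists>y<n. y \<in> s i \<and>
        (\<forall>x<n. \<forall>j<m. x \<noteq> y \<and> y \<in> s j \<or> x = y \<and> j = \<tau> y \<longrightarrow> x * m + j \<notin> S)))"
proof -
  define V where "V w \<longleftrightarrow> wire_vals C S ! w" for w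
  have V0: "V i \<longleftrightarrow> i \<in> S" if "i < N" for i
    using wire_vals_input[of i C S] that by (simp add: V_def inputs_C)
  have gate: "V w = gate_val (wire_vals C S) (gate_at C w)" if "N \<le> w" "w \<le> 2 * N + 4 * n + m" for w
    using wire_vals_gate[OF wf_extension_circuit, of w S] that by (simp add: V_def is_gate_def inputs_C length_gates_C)
  have V1: "V (N + i) \<longleftrightarrow> i \<notin> S" if "i < N" for i
    using gate[of "N + i"] gate_at_C(1)[OF that] V0[OF that] that by (simp add: V_def)
  have V2: "V (2 * N + y) \<longleftrightarrow>
      (\<forall>x<n. \<forall>j<m. x \<noteq> y \<and> y \<in> s j \<or> x = y \<and> j = \<tau> y \<longrightarrow> x * m + j \<notin> S)" if "y < n" for y
  proof -
    have "V (2 * N + y) \<longleftrightarrow> (\<forall>u\<in>set (conflict_list n m s \<tau> y). V u)"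
      using gate[of "2 * N + y"] gate_at_C(2)[OF that] that by (simp add: V_def)
    also have "\<dots> \<longleftrightarrow> (\<forall>x<n. \<forall>j<m. x \<noteq> y \<and> y \<in> s j \<or> x = y \<and> j = \<tau> y \<longrightarrow> V (n * m + (x * m + j)))"
      unfolding N set_conflict_list by blast
    also have "\<dots> \<longleftrightarrow> (\<forall>x<n. \<forall>j<m. x \<noteq> y \<and> y \<in> s j \<or> x = y \<and> j = \<tau> y \<longrightarrow> x * m + j \<notin> S)"
      using V1[folded N, OF pair_index_less] by blast
    finally show ?thesis .
  qed
  have V3: "V (2 * N + n + y) \<longleftrightarrow> (\<forall>x<n. \<tau> y < m \<longrightarrow> (x * m + \<tau> y \<in> S \<longleftrightarrow> x = y))" if "y < n" for y
  proof -
    have "V (2 * N + n + y) \<longleftrightarrow> (\<forall>u\<in>set (keep_one_list n m \<tau> y). V u)"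
      using gate[of "2 * N + n + y"] gate_at_C(3)[OF that] that by (simp add: V_def)
    also have "\<dots> \<longleftrightarrow> (\<forall>x<n. \<tau> y < m \<longrightarrow> V (if x = y then x * m + \<tau> y else n * m + (x * m + \<tau> y)))"
      unfolding N set_keep_one_list by blast
    also have "\<dots> \<longleftrightarrow> (\<forall>x<n. \<tau> y < m \<longrightarrow> (x * m + \<tau> y \<in> S \<longleftrightarrow> x = y))"
    proof -
      have "V (if x = y then x * m + \<tau> y else n * m + (x * m + \<tau> y)) \<longleftrightarrow> (x * m + \<tau> y \<in> S \<longleftrightarrow> x = y)"
        if "x < n" "\<tau> y < m" for x
        using V1[folded N, OF pair_index_less[OF that]] V0[folded N, OF pair_index_less[OF that]] by auto
      then show ?thesis by blast
    qed
    finally show ?thesis .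
  qed
  have V4: "V (2 * N + 2 * n + y) \<longleftrightarrow> V (2 * N + y) \<or> V (2 * N + n + y)" if "y < n" for y
    using gate[of "2 * N + 2 * n + y"] gate_at_C(4)[OF that] that by (simp add: V_def)
  have V5: "V (2 * N + 3 * n + y) \<longleftrightarrow> (\<exists>j<m. y \<in> s j \<and> \<not> (f y = 2 \<and> j = \<tau> y) \<and> y * m + j \<in> S)"
    if "y < n" for y
  proof -
    have "V (2 * N + 3 * n + y) \<longleftrightarrow> (\<exists>u\<in>set (choice_list m s \<tau> f y). V u)"
      using gate[of "2 * N + 3 * n + y"] gate_at_C(5)[OF that] that by (simp add: V_def)
    also have "\<dots> \<longleftrightarrow> (\<exists>j<m. y \<in> s j \<and> \<not> (f y = 2 \<and> j = \<tau> y) \<and> V (y * m + j))"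
      unfolding set_choice_list by blast
    also have "\<dots> \<longleftrightarrow> (\<exists>j<m. y \<in> s j \<and> \<not> (f y = 2 \<and> j = \<tau> y) \<and> y * m + j \<in> S)"
      using V0[folded N, OF pair_index_less[OF that]] by blast
    finally show ?thesis .
  qed
  have V6: "V (2 * N + 4 * n + i) \<longleftrightarrow> (\<exists>y<n. y \<in> s i \<and> V (2 * N + y))" if "i < m" for i
  proof -
    have "V (2 * N + 4 * n + i) \<longleftrightarrow> (\<exists>u\<in>set (cover_list n m s i). V u)"
      using gate[of "2 * N + 4 * n + i"] gate_at_C(6)[OF that] that by (simp add: V_def)
    then show ?thesis unfolding set_cover_list by blast
  qed
  have "satisfies C S \<longleftrightarrow> V (2 * N + 4 * n + m)" by (simp add: satisfies_def V_def out_wire_C)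
  also have "\<dots> \<longleftrightarrow> (\<forall>u\<in>set (output_list n m \<tau> f). V u)"
    using gate[of "2 * N + 4 * n + m"] gate_at_C(7) by (simp add: V_def)
  also have "\<dots> \<longleftrightarrow> (\<forall>y<n. f y \<noteq> 0 \<longrightarrow> V (2 * N + 2 * n + y)) \<and>
      (\<forall>y<n. f y \<noteq> 0 \<longrightarrow> V (2 * N + 3 * n + y)) \<and>
      (\<forall>i<m. i \<notin> \<tau> ` {..<n} \<longrightarrow> V (2 * N + 4 * n + i))"
    unfolding set_output_list by blast
  finally show ?thesis using V2 V3 V4 V5 V6 by (simp cong: conj_cong)
qed

text \<open>The choice gates force a true input in the row of every vertex of the support. As
  \<open>S\<close> has only as many elements as the support, each of these rows has exactly one and
  no other input is true: \<open>S\<close> is the graph of \<open>q\<close>.\<close>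

lemma extension_iff_weighted_sat:
  assumes "is_hypergraph (nat_hypergraph n m s)" "correspondence (nat_hypergraph n m s) \<tau>"
    "f \<in> verts (nat_hypergraph n m s) \<rightarrow> {0, 1, 2}"
  shows "extension_rhf_yes (nat_hypergraph n m s) \<tau> f \<longleftrightarrow>
    (\<exists>S\<subseteq>{..<inputs C}. card S = card {x. x < n \<and> f x \<noteq> 0} \<and> satisfies C S)"
proof -
  let ?H = "nat_hypergraph n m s"
  define F where "F = {x. x < n \<and> f x \<noteq> 0}"
  have FV: "F \<subseteq> {..<n}" by (auto simp: F_def)
  have sub: "s i \<subseteq> {..<n}" if "i < m" for i
    using assms(1) that by (auto simp: is_hypergraph_def nat_hypergraph_def)
  have \<tau>: "\<tau> x < m" if "x < n" for x
    using assms(2) that by (auto simp: correspondence_def nat_hypergraph_def)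
  have eq: "satisfies C S \<longleftrightarrow> reservation ?H \<tau> f F q"
    if q: "\<And>x. x \<in> F \<Longrightarrow> q x < m \<and> x \<in> s (q x) \<and> (f x = 2 \<longrightarrow> q x \<noteq> \<tau> x)"
      and S: "\<And>x j. x < n \<Longrightarrow> j < m \<Longrightarrow> x * m + j \<in> S \<longleftrightarrow> x \<in> F \<and> j = q x" for q S
  proof -
    have el: "(\<forall>x<n. \<forall>j<m. x \<noteq> y \<and> y \<in> s j \<or> x = y \<and> j = \<tau> y \<longrightarrow> x * m + j \<notin> S) \<longleftrightarrow>
        eligible ?H \<tau> F q y" if "y < n" for y
    proof -
      have "(\<forall>x<n. \<forall>j<m. x \<noteq> y \<and> y \<in> s j \<or> x = y \<and> j = \<tau> y \<longrightarrow> x * m + j \<notin> S) \<longleftrightarrow>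
          (\<forall>x<n. \<forall>j<m. x \<noteq> y \<and> y \<in> s j \<or> x = y \<and> j = \<tau> y \<longrightarrow> \<not> (x \<in> F \<and> j = q x))"
        using S by blast
      also have "\<dots> \<longleftrightarrow> (\<forall>x\<in>F. x \<noteq> y \<longrightarrow> y \<notin> s (q x)) \<and> (y \<in> F \<longrightarrow> q y \<noteq> \<tau> y)"
        using q \<tau>[OF that] that FV by blast
      finally show ?thesis by (simp add: eligible_def nat_hypergraph_def)
    qed
    have keep: "(\<forall>x<n. \<tau> y < m \<longrightarrow> (x * m + \<tau> y \<in> S \<longleftrightarrow> x = y)) \<longleftrightarrow>
        q y = \<tau> y \<and> (\<forall>x\<in>F. x \<noteq> y \<longrightarrow> q x \<noteq> \<tau> y)" if "y \<in> F" for y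
      using S \<tau>[of y] that unfolding F_def by auto
    have choice: "\<exists>j<m. y \<in> s j \<and> \<not> (f y = 2 \<and> j = \<tau> y) \<and> y * m + j \<in> S" if "y \<in> F" for y
      using q[OF that] S[of y "q y"] that by (auto simp: F_def)
    have "satisfies C S \<longleftrightarrow>
        (\<forall>y\<in>F. eligible ?H \<tau> F q y \<or> q y = \<tau> y \<and> (\<forall>x\<in>F. x \<noteq> y \<longrightarrow> q x \<noteq> \<tau> y)) \<and>
        (\<forall>i<m. i \<notin> \<tau> ` {..<n} \<longrightarrow> (\<exists>y<n. y \<in> s i \<and> eligible ?H \<tau> F q y))"
      unfolding satisfies_extension_circuit_iff using el keep choice by (simp add: F_def cong: conj_cong) blast
    also have "\<dots> \<longleftrightarrow> reservation ?H \<tau> f F q"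
    proof -
      have "(\<exists>y<n. y \<in> s i \<and> E y) \<longleftrightarrow> (\<exists>y\<in>s i. E y)" if "i < m" for i E
        using sub[OF that] by blast
      moreover have "verts ?H = {..<n}" "idx ?H = {..<m}" "edge ?H = s"
        by (simp_all add: nat_hypergraph_def)
      ultimately show ?thesis unfolding reservation_def using q by (simp add: Ball_def)
    qed
    finally show ?thesis .
  qed
  have "(\<exists>q. reservation ?H \<tau> f F q) \<longleftrightarrow> (\<exists>S\<subseteq>{..<N}. card S = card F \<and> satisfies C S)"
  proof
    assume "\<exists>q. reservation ?H \<tau> f F q"
    then obtain q where res: "reservation ?H \<tau> f F q" by blast
    then have q: "q x < m \<and> x \<in> s (q x) \<and> (f x = 2 \<longrightarrow> q x \<noteq> \<tau> x)" if "x \<in> F" for x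
      using that by (auto simp: reservation_def nat_hypergraph_def)
    define S where "S = (\<lambda>x. x * m + q x) ` F"
    have S: "x * m + j \<in> S \<longleftrightarrow> x \<in> F \<and> j = q x" if "x < n" "j < m" for x j
      using q pair_index_inject[OF that(2)] unfolding S_def by blast
    have "inj_on (\<lambda>x. x * m + q x) F"
      using q pair_index_inject by (intro inj_onI) blast
    then have "card S = card F" by (simp add: S_def card_image)
    moreover have "S \<subseteq> {..<N}" using q pair_index_less[of _ n _ m, unfolded N] by (auto simp: S_def F_def)
    ultimately show "\<exists>S\<subseteq>{..<N}. card S = card F \<and> satisfies C S" using eq[OF q S] res by blast
  next
    assume "\<exists>S\<subseteq>{..<N}. card S = card F \<and> satisfies C S"
    then obtain S where S: "S \<subseteq> {..<N}" "card S = card F" "satisfies C S" by blast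
    have "\<exists>j. j < m \<and> x \<in> s j \<and> \<not> (f x = 2 \<and> j = \<tau> x) \<and> x * m + j \<in> S" if "x \<in> F" for x
      using S(3) that unfolding satisfies_extension_circuit_iff F_def by blast
    then obtain q where q: "\<And>x. x \<in> F \<Longrightarrow> q x < m \<and> x \<in> s (q x) \<and> \<not> (f x = 2 \<and> q x = \<tau> x) \<and> x * m + q x \<in> S"
      by metis
    have "inj_on (\<lambda>x. x * m + q x) F"
      using q pair_index_inject by (intro inj_onI) blast
    then have "card ((\<lambda>x. x * m + q x) ` F) = card S" using S(2) by (simp add: card_image)
    moreover have "(\<lambda>x. x * m + q x) ` F \<subseteq> S" using q by auto
    moreover have "finite S" using S(1) finite_subset by blast
    ultimately have im: "S = (\<lambda>x. x * m + q x) ` F" using card_subset_eq by blast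
    have "x * m + j \<in> S \<longleftrightarrow> x \<in> F \<and> j = q x" if "x < n" "j < m" for x j
      using q pair_index_inject[OF that(2)] unfolding im by blast
    then have "reservation ?H \<tau> f F q" using eq[of q S] q S(3) by blast
    then show "\<exists>q. reservation ?H \<tau> f F q" by blast
  qed
  moreover have "{x \<in> verts ?H. f x \<noteq> 0} = F" by (auto simp: F_def nat_hypergraph_def)
  ultimately show ?thesis
    using extension_rhf_yes_iff_reservation[OF assms] by (simp add: inputs_C F_def)
qed

end

section \<open>A language of bounded sums and its cost\<close>

section \<open>A polynomial-time language\<close>

text \<open>
  A program has a value and, as a side effect, an output; \<open>Plus\<close> also serves as sequential
  composition and \<open>Sum\<close> as a bounded loop.  \<open>Cell\<close> reads a fixed array.
\<close>

datatype prog =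
    Num nat
  | Var nat
  | Plus prog prog
  | Minus prog prog
  | Cell prog
  | Sum nat prog prog
  | Emit bool

primrec val :: "(nat \<Rightarrow> nat) \<Rightarrow> prog \<Rightarrow> (nat \<Rightarrow> nat) \<Rightarrow> nat" where
  "val A (Num n) \<rho> = n"
| "val A (Var v) \<rho> = \<rho> v"
| "val A (Plus a e) \<rho> = val A a \<rho> + val A e \<rho>"
| "val A (Minus a e) \<rho> = val A a \<rho> - val A e \<rho>"
| "val A (Cell a) \<rho> = A (val A a \<rho>)"
| "val A (Sum v a e) \<rho> = (\<Sum>j<val A a \<rho>. val A e (\<rho>(v := j)))"
| "val A (Emit b) \<rho> = 0"

primrec out :: "(nat \<Rightarrow> nat) \<Rightarrow> prog \<Rightarrow> (nat \<Rightarrow> nat) \<Rightarrow> bool list" where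
  "out A (Num n) \<rho> = []"
| "out A (Var v) \<rho> = []"
| "out A (Plus a e) \<rho> = out A a \<rho> @ out A e \<rho>"
| "out A (Minus a e) \<rho> = out A a \<rho> @ out A e \<rho>"
| "out A (Cell a) \<rho> = out A a \<rho>"
| "out A (Sum v a e) \<rho> = out A a \<rho> @ concat (map (\<lambda>j. out A e (\<rho>(v := j))) [0..<val A a \<rho>])"
| "out A (Emit b) \<rho> = [b]"

text \<open>The exact number of instructions that the compiled code executes. A loop takes 3 to
  initialise, 7 per round besides its body, and 4 for the last test and the two final
  copies.\<close>

primrec time :: "(nat \<Rightarrow> nat) \<Rightarrow> prog \<Rightarrow> (nat \<Rightarrow> nat) \<Rightarrow> nat" where
  "time A (Num n) \<rho> = 1"
| "time A (Var v) \<rho> = 1"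
| "time A (Plus a e) \<rho> = time A a \<rho> + time A e \<rho> + 1"
| "time A (Minus a e) \<rho> = time A a \<rho> + time A e \<rho> + 1"
| "time A (Cell a) \<rho> = time A a \<rho> + 3"
| "time A (Sum v a e) \<rho> =
     time A a \<rho> + 3 + (\<Sum>j<val A a \<rho>. time A e (\<rho>(v := j)) + 7) + 4"
| "time A (Emit b) \<rho> = 3"

section \<open>Polynomial time\<close>

lemma le_power_trans: "(x::nat) \<le> X ^ a \<Longrightarrow> 2 \<le> X \<Longrightarrow> a \<le> c \<Longrightarrow> x \<le> X ^ c"
  by (rule order_trans[OF _ power_increasing]) auto

lemma add_le_power_Suc:
  assumes "(x::nat) \<le> X ^ c" "y \<le> X ^ c" "2 \<le> X"
  shows "x + y \<le> X ^ Suc c"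
proof -
  have "x + y \<le> 2 * X ^ c" using assms by simp
  also have "\<dots> \<le> X ^ Suc c" using assms by simp
  finally show ?thesis .
qed

text \<open>The exponent depends on the program alone, and \<open>X\<close> bounds all variables and
  cells at once. As \<open>X\<close> is at least 2, constants and sums are absorbed by raising the
  exponent.\<close>

definition poly_bounded :: "prog \<Rightarrow> nat \<Rightarrow> bool" where
  "poly_bounded e c \<longleftrightarrow> (\<forall>A \<rho> X. 2 \<le> X \<and> (\<forall>r. \<rho> r \<le> X) \<and> (\<forall>a. A a \<le> X) \<longrightarrow>
     val A e \<rho> \<le> X ^ c \<and> time A e \<rho> \<le> X ^ c)"

lemma poly_boundedI:
  assumes "\<And>A \<rho> X. 2 \<le> X \<Longrightarrow> (\<And>r. \<rho> r \<le> X) \<Longrightarrow> (\<And>a. A a \<le> X) \<Longrightarrow>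
    val A e \<rho> \<le> X ^ c \<and> time A e \<rho> \<le> X ^ c"
  shows "poly_bounded e c"
  using assms unfolding poly_bounded_def by blast

lemma poly_boundedD:
  assumes "poly_bounded e c" "c \<le> d" "2 \<le> X" "\<And>r. \<rho> r \<le> X" "\<And>a. A a \<le> X"
  shows "val A e \<rho> \<le> X ^ d" "time A e \<rho> \<le> X ^ d"
proof -
  have "val A e \<rho> \<le> X ^ c" "time A e \<rho> \<le> X ^ c"
    using assms unfolding poly_bounded_def by blast+
  then show "val A e \<rho> \<le> X ^ d" "time A e \<rho> \<le> X ^ d"
    using assms(2,3) by (auto intro: le_power_trans)
qed

lemma poly_bounded_binary:
  assumes a: "poly_bounded a c" and e: "poly_bounded e d"
    and v: "\<And>A \<rho>. val A e' \<rho> \<le> val A a \<rho> + val A e \<rho>"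
    and t: "\<And>A \<rho>. time A e' \<rho> = time A a \<rho> + time A e \<rho> + 1"
  shows "poly_bounded e' (Suc (Suc (c + d)))"
proof (rule poly_boundedI)
  fix A \<rho> :: "nat \<Rightarrow> nat" and X :: nat
  assume X: "2 \<le> X" "\<And>r. \<rho> r \<le> X" "\<And>a. A a \<le> X"
  note a' = poly_boundedD[where A = A and \<rho> = \<rho>, OF a le_add1[of c d] X] and e' = poly_boundedD[where A = A and \<rho> = \<rho>, OF e le_add2[of d c] X]
  have "val A e' \<rho> \<le> X ^ Suc (c + d)"
    using v[of A \<rho>] add_le_power_Suc[OF a'(1) e'(1) X(1)] by linarith
  moreover have "1 \<le> X ^ Suc (c + d)" using X(1) by simp
  ultimately show "val A e' \<rho> \<le> X ^ Suc (Suc (c + d)) \<and> time A e' \<rho> \<le> X ^ Suc (Suc (c + d))"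
    using add_le_power_Suc[OF add_le_power_Suc[OF a'(2) e'(2) X(1)] _ X(1), of 1] X(1)
    unfolding t by (auto intro: le_power_trans simp del: power_Suc)
qed

text \<open>Only a loop sets a variable, and its range is fixed before the first round. Hence nested
  loops compose polynomials and never iterate them.\<close>

lemma ex_poly_bounded: "\<exists>c. poly_bounded e c"
proof (induction e)
  case (Num n)
  have "val A (Num n) \<rho> \<le> X ^ Suc n \<and> time A (Num n) \<rho> \<le> X ^ Suc n" if "2 \<le> X" for A \<rho> X
  proof -
    have "n < 2 ^ n" by (rule less_exp)
    also have "\<dots> \<le> X ^ n" using that by (rule power_mono) simp
    finally have "n \<le> X ^ n" by simp
    moreover have "1 \<le> X ^ n" using that by simp
    ultimately show ?thesis using add_le_power_Suc[OF _ _ that, of n n 1] by (simp del: power_Suc)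
  qed
  then show ?case by (blast intro: poly_boundedI)
next
  case (Var v)
  show ?case by (rule exI[of _ 1], rule poly_boundedI) (simp add: le_trans[of 1 2])
next
  case (Emit b)
  have "3 \<le> X ^ 2" if "2 \<le> X" for X :: nat
    using power_mono[OF that, of 2] by simp
  then show ?case by (intro exI[of _ 2] poly_boundedI) simp
next
  case (Plus a e)
  then obtain c d where "poly_bounded a c" "poly_bounded e d" by blast
  then have "poly_bounded (Plus a e) (Suc (Suc (c + d)))" by (rule poly_bounded_binary) simp_all
  then show ?case ..
next
  case (Minus a e)
  then obtain c d where "poly_bounded a c" "poly_bounded e d" by blast
  then have "poly_bounded (Minus a e) (Suc (Suc (c + d)))" by (rule poly_bounded_binary) simp_all
  then show ?case ..
next
  case (Cell a)
  then obtain c where c: "poly_bounded a c" by blast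
  have "poly_bounded (Cell a) (Suc (c + 2))"
  proof (rule poly_boundedI)
    fix A \<rho> :: "nat \<Rightarrow> nat" and X :: nat
    assume X: "2 \<le> X" "\<And>r. \<rho> r \<le> X" "\<And>a. A a \<le> X"
    have "3 \<le> X ^ 2" using power_mono[OF X(1), of 2] by simp
    then have "3 \<le> X ^ (c + 2)" using X(1) by (rule le_power_trans) simp
    from add_le_power_Suc[OF poly_boundedD(2)[where A = A and \<rho> = \<rho>, OF c _ X, of "c + 2"] this X(1)]
    have "time A (Cell a) \<rho> \<le> X ^ Suc (c + 2)" by (simp del: power_Suc)
    moreover have "val A (Cell a) \<rho> \<le> X ^ Suc (c + 2)"
      using le_power_trans[of "val A (Cell a) \<rho>" X 1 "Suc (c + 2)"] X by simp
    ultimately show "val A (Cell a) \<rho> \<le> X ^ Suc (c + 2) \<and> time A (Cell a) \<rho> \<le> X ^ Suc (c + 2)" by blast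
  qed
  then show ?case ..
next
  case (Sum v a e)
  then obtain c d where c: "poly_bounded a c" and d: "poly_bounded e d" by blast
  \<comment> \<open>In the body the index may reach \<open>X ^ c\<close>, so the bound of
    \<open>e\<close> is used with base \<open>X + X ^ c\<close>, which is at most
    \<open>X ^ (c + 2)\<close>. The extra 3 in the exponent absorbs the 7 steps of overhead per
    round.\<close>
  define h where "h = Suc (c + 1) * d + 3"
  have "poly_bounded (Sum v a e) (Suc (Suc (c + Suc h + 3)))"
  proof (rule poly_boundedI)
    fix A \<rho> :: "nat \<Rightarrow> nat" and X :: nat
    assume X: "2 \<le> X" "\<And>r. \<rho> r \<le> X" "\<And>a. A a \<le> X"
    let ?L = "val A a \<rho>" and ?Y = "X + X ^ c"
    have L: "?L \<le> X ^ c" using poly_boundedD(1)[where A = A and \<rho> = \<rho>, OF c le_refl X] .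
    have "X \<le> X ^ (c + 1)" "X ^ c \<le> X ^ (c + 1)" using X(1) by auto
    then have "?Y \<le> X ^ Suc (c + 1)" using X(1) by (rule add_le_power_Suc)
    then have "?Y ^ d \<le> (X ^ Suc (c + 1)) ^ d" by (rule power_mono) simp
    also have "\<dots> = X ^ (Suc (c + 1) * d)" by (simp only: power_mult)
    finally have Y: "?Y ^ d \<le> X ^ h" using X(1) unfolding h_def by (rule le_power_trans) simp
    have seven: "7 \<le> X ^ 3" using power_mono[OF X(1), of 3] by simp
    then have seven': "7 \<le> X ^ h" using X(1) unfolding h_def by (rule le_power_trans) simp
    have e: "val A e (\<rho>(v := j)) \<le> X ^ Suc h" "time A e (\<rho>(v := j)) + 7 \<le> X ^ Suc h"
      if "j < ?L" for j
    proof -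
      have "2 \<le> ?Y" "\<And>r. (\<rho>(v := j)) r \<le> ?Y" "\<And>a. A a \<le> ?Y"
        using X that L by (auto intro: trans_le_add1)
      note e' = poly_boundedD[where A = A and \<rho> = "\<rho>(v := j)", OF d le_refl this]
      show "val A e (\<rho>(v := j)) \<le> X ^ Suc h"
        using order_trans[OF e'(1) Y] X(1) by (rule le_power_trans) simp
      show "time A e (\<rho>(v := j)) + 7 \<le> X ^ Suc h"
        using order_trans[OF e'(2) Y] seven' X(1) by (rule add_le_power_Suc)
    qed
    have s: "(\<Sum>j<?L. g j) \<le> X ^ (c + Suc h)" if "\<And>j. j < ?L \<Longrightarrow> g j \<le> X ^ Suc h" for g
    proof -
      have "(\<Sum>j<?L. g j) \<le> of_nat (card {..<?L}) * X ^ Suc h"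
        using that by (intro sum_bounded_above) auto
      also have "\<dots> \<le> X ^ c * X ^ Suc h" using L by (intro mult_le_mono) auto
      finally show ?thesis by (simp only: power_add)
    qed
    have "(\<Sum>j<?L. time A e (\<rho>(v := j)) + 7) \<le> X ^ (c + Suc h + 3)"
      using s[OF e(2)] X(1) by (rule le_power_trans) simp_all
    moreover have "time A a \<rho> \<le> X ^ (c + Suc h + 3)"
      by (rule poly_boundedD(2)[OF c _ X]) simp
    moreover have "7 \<le> X ^ Suc (c + Suc h + 3)" using seven X(1) by (rule le_power_trans) simp
    ultimately have "time A a \<rho> + (\<Sum>j<?L. time A e (\<rho>(v := j)) + 7) + 7 \<le> X ^ Suc (Suc (c + Suc h + 3))"
      using X(1) by (intro add_le_power_Suc)
    moreover have "val A (Sum v a e) \<rho> \<le> X ^ Suc (Suc (c + Suc h + 3))"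
    proof (rule le_power_trans)
      show "val A (Sum v a e) \<rho> \<le> X ^ (c + Suc h)" using s[OF e(1)] by simp
    qed (use X(1) in auto)
    ultimately show "val A (Sum v a e) \<rho> \<le> X ^ Suc (Suc (c + Suc h + 3)) \<and>
        time A (Sum v a e) \<rho> \<le> X ^ Suc (Suc (c + Suc h + 3))"
      unfolding time.simps by (simp del: power_Suc val.simps)
  qed
  then show ?case ..
qed

section \<open>Simulation on random access machines\<close>

section \<open>Compilation\<close>

text \<open>The length depends neither on the target register nor on the address, so absolute jump
  targets can be computed while the code is being generated.\<close>

primrec code_length :: "prog \<Rightarrow> nat" where
  "code_length (Num n) = 1"
| "code_length (Var v) = 1"
| "code_length (Plus a e) = code_length a + code_length e + 1"
| "code_length (Minus a e) = code_length a + code_length e + 1"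
| "code_length (Cell a) = code_length a + 3"
| "code_length (Sum v a e) = code_length a + code_length e + 12"
| "code_length (Emit b) = 3"

text \<open>
  Variable \<open>v\<close> lives in register \<open>v\<close>, the array starts at register \<open>b\<close>, and code placed at address \<open>p\<close>
  leaves its value in register \<open>d\<close> and only uses registers from \<open>d\<close> on as temporaries.  \<open>Sum\<close> saves and
  restores the register of its bound variable.
\<close>

primrec compile :: "nat \<Rightarrow> prog \<Rightarrow> nat \<Rightarrow> nat \<Rightarrow> instr list" where
  "compile b (Num n) d p = [Const d n]"
| "compile b (Var v) d p = [Copy d v]"
| "compile b (Plus a e) d p =
     compile b a d p @ compile b e (d + 1) (p + code_length a) @ [Add d d (d + 1)]"
| "compile b (Minus a e) d p =
     compile b a d p @ compile b e (d + 1) (p + code_length a) @ [Sub d d (d + 1)]"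
| "compile b (Cell a) d p = compile b a d p @ [Const (d + 1) b, Add d d (d + 1), Load d d]"
| "compile b (Sum v a e) d p = compile b a d p @
     (let q = p + code_length a; r = q + 5 + code_length e in
       [Const (d + 1) 0, Copy (d + 2) v, Const v 0, Sub (d + 3) d v, Jump_zero (d + 3) (r + 5)] @
       compile b e (d + 3) (q + 5) @
       [Add (d + 1) (d + 1) (d + 3), Const (d + 3) 1, Add v v (d + 3), Const (d + 3) 0,
        Jump_zero (d + 3) (q + 3), Copy d (d + 1), Copy v (d + 2)])"
| "compile b (Emit c) d p = [Const d (of_bool c), Write d, Const d 0]"

lemma length_compile [simp]: "length (compile b e d p) = code_length e"
  by (induction e arbitrary: d p) (auto simp: Let_def)

primrec vars_below :: "nat \<Rightarrow> prog \<Rightarrow> bool" where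
  "vars_below V (Num n) \<longleftrightarrow> True"
| "vars_below V (Var v) \<longleftrightarrow> v < V"
| "vars_below V (Plus a e) \<longleftrightarrow> vars_below V a \<and> vars_below V e"
| "vars_below V (Minus a e) \<longleftrightarrow> vars_below V a \<and> vars_below V e"
| "vars_below V (Cell a) \<longleftrightarrow> vars_below V a"
| "vars_below V (Sum v a e) \<longleftrightarrow> v < V \<and> vars_below V a \<and> vars_below V e"
| "vars_below V (Emit b) \<longleftrightarrow> True"

text \<open>A bound on the number of registers needed from \<open>d\<close> on; it determines how
  far up the array must start.\<close>

primrec temps :: "prog \<Rightarrow> nat" where
  "temps (Num n) = 1"
| "temps (Var v) = 1"
| "temps (Plus a e) = temps a + temps e + 2"
| "temps (Minus a e) = temps a + temps e + 2"
| "temps (Cell a) = temps a + 2"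
| "temps (Sum v a e) = temps a + temps e + 4"
| "temps (Emit b) = 1"

lemma vars_below_mono: "vars_below V e \<Longrightarrow> V \<le> W \<Longrightarrow> vars_below W e"
  by (induction e) auto

lemma ex_vars_below: "\<exists>V. vars_below V e"
proof (induction e)
  case (Plus a e)
  then obtain V W where "vars_below V a" "vars_below W e" by auto
  then show ?case by (auto intro!: exI[of _ "V + W"] elim: vars_below_mono)
next
  case (Minus a e)
  then obtain V W where "vars_below V a" "vars_below W e" by auto
  then show ?case by (auto intro!: exI[of _ "V + W"] elim: vars_below_mono)
next
  case (Sum v a e)
  then obtain V W where "vars_below V a" "vars_below W e" by auto
  then show ?case by (auto intro!: exI[of _ "V + W + Suc v"] elim: vars_below_mono)
qed auto

definition code_at :: "instr list \<Rightarrow> nat \<Rightarrow> instr list \<Rightarrow> bool" where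
  "code_at P p is \<longleftrightarrow> (\<forall>i<length is. p + i < length P \<and> P ! (p + i) = is ! i)"

lemma code_at_Nil [simp]: "code_at P p []"
  by (simp add: code_at_def)

lemma code_at_Cons [simp]:
  "code_at P p (i # is) \<longleftrightarrow> p < length P \<and> P ! p = i \<and> code_at P (Suc p) is"
  by (auto simp: code_at_def less_Suc_eq_0_disj)

lemma code_at_append [simp]:
  "code_at P p (is @ js) \<longleftrightarrow> code_at P p is \<and> code_at P (p + length is) js"
proof (induction "is" arbitrary: p)
  case (Cons i "is")
  then show ?case by simp
qed simp

definition run :: "instr list \<Rightarrow> nat \<Rightarrow> config \<Rightarrow> config" where
  "run P t c = (ram_step P ^^ t) c"

lemma run_0 [simp]: "run P 0 c = c"
  by (simp add: run_def)

lemma run_add: "run P (s + t) c = run P t (run P s c)"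
  by (simp add: run_def add.commute[of s] funpow_add)

lemma run_Suc:
  "p < length P \<Longrightarrow> run P (Suc t) (Config p M u w) = run P t (exec_instr (P ! p) (Config p M u w))"
  by (simp add: run_def funpow_swap1 ram_step_def halted_def del: funpow.simps(2) add: funpow_Suc_right)

lemma run_trans: "run P s c = c' \<Longrightarrow> run P t c' = c'' \<Longrightarrow> run P (s + t) c = c''"
  by (simp add: run_add)

text \<open>The frame condition makes the induction compose: registers below \<open>d\<close> hold
  the variables and pending intermediate results, registers from \<open>b\<close> on hold the array.
  Since the time is exact, runs are concatenated by adding step counts.\<close>

lemma compile_correct:
  assumes "vars_below V e" "V \<le> d" "d + temps e \<le> b" "code_at P p (compile b e d p)"
    "\<And>r. r < V \<Longrightarrow> M r = \<rho> r" "\<And>a. M (b + a) = A a"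
  shows "\<exists>M'. run P (time A e \<rho>) (Config p M u w) =
           Config (p + code_length e) M' u (w @ out A e \<rho>) \<and>
         M' d = val A e \<rho> \<and> (\<forall>r. r < d \<or> b \<le> r \<longrightarrow> M' r = M r)"
  using assms
proof (induction e arbitrary: d p M \<rho> w)
  case (Num n)
  then show ?case by (auto simp: run_Suc)
next
  case (Var v)
  then show ?case by (auto simp: run_Suc)
next
  case (Emit c)
  then show ?case by (auto simp: run_Suc numeral_3_eq_3)
next
  case (Plus a e)
  obtain M1 where M1: "run P (time A a \<rho>) (Config p M u w) =
      Config (p + code_length a) M1 u (w @ out A a \<rho>)"
    "M1 d = val A a \<rho>" "\<And>r. r < d \<or> b \<le> r \<Longrightarrow> M1 r = M r"
    using Plus.IH(1)[of d p M \<rho> w] Plus.prems by auto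
  obtain M2 where M2: "run P (time A e \<rho>) (Config (p + code_length a) M1 u (w @ out A a \<rho>)) =
      Config (p + code_length a + code_length e) M2 u (w @ out A a \<rho> @ out A e \<rho>)"
    "M2 (d + 1) = val A e \<rho>" "\<forall>r. r < d + 1 \<or> b \<le> r \<longrightarrow> M2 r = M1 r"
    using Plus.IH(2)[of "d + 1" "p + code_length a" M1 \<rho> "w @ out A a \<rho>"] Plus.prems M1(3)
    by (simp del: all_simps) blast
  have "run P 1 (Config (p + code_length a + code_length e) M2 u (w @ out A a \<rho> @ out A e \<rho>)) =
      Config (p + code_length (Plus a e)) (M2(d := M2 d + M2 (d + 1))) u (w @ out A (Plus a e) \<rho>)"
    using Plus.prems by (simp add: run_Suc)
  from run_trans[OF run_trans[OF M1(1) M2(1)] this] show ?case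
    using M1(2,3) M2(2,3) Plus.prems by auto
next
  case (Minus a e)
  obtain M1 where M1: "run P (time A a \<rho>) (Config p M u w) =
      Config (p + code_length a) M1 u (w @ out A a \<rho>)"
    "M1 d = val A a \<rho>" "\<And>r. r < d \<or> b \<le> r \<Longrightarrow> M1 r = M r"
    using Minus.IH(1)[of d p M \<rho> w] Minus.prems by auto
  obtain M2 where M2: "run P (time A e \<rho>) (Config (p + code_length a) M1 u (w @ out A a \<rho>)) =
      Config (p + code_length a + code_length e) M2 u (w @ out A a \<rho> @ out A e \<rho>)"
    "M2 (d + 1) = val A e \<rho>" "\<forall>r. r < d + 1 \<or> b \<le> r \<longrightarrow> M2 r = M1 r"
    using Minus.IH(2)[of "d + 1" "p + code_length a" M1 \<rho> "w @ out A a \<rho>"] Minus.prems M1(3)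
    by (simp del: all_simps) blast
  have "run P 1 (Config (p + code_length a + code_length e) M2 u (w @ out A a \<rho> @ out A e \<rho>)) =
      Config (p + code_length (Minus a e)) (M2(d := M2 d - M2 (d + 1))) u (w @ out A (Minus a e) \<rho>)"
    using Minus.prems by (simp add: run_Suc)
  from run_trans[OF run_trans[OF M1(1) M2(1)] this] show ?case
    using M1(2,3) M2(2,3) Minus.prems by auto
next
  case (Cell a)
  obtain M1 where M1: "run P (time A a \<rho>) (Config p M u w) =
      Config (p + code_length a) M1 u (w @ out A a \<rho>)"
    "M1 d = val A a \<rho>" "\<And>r. r < d \<or> b \<le> r \<Longrightarrow> M1 r = M r"
    using Cell.IH(1)[of d p M \<rho> w] Cell.prems by auto
  define M2 where "M2 = M1(d + 1 := b, d := A (val A a \<rho>))"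
  have "M1 (val A a \<rho> + b) = A (val A a \<rho>)" 
    using Cell.prems(6)[of "val A a \<rho>"] M1(3)[of "val A a \<rho> + b"] by (simp add: add.commute)
  then have "run P 3 (Config (p + code_length a) M1 u (w @ out A a \<rho>)) =
      Config (p + code_length (Cell a)) M2 u (w @ out A (Cell a) \<rho>)"
    using Cell.prems M1(2) by (auto simp: run_Suc numeral_3_eq_3 M2_def)
  from run_trans[OF M1(1) this] show ?case
    using M1(2,3) Cell.prems by (auto simp: M2_def)
next
  case (Sum v a e)
  define q where "q = p + code_length a"
  define s where "s = q + 5 + code_length e"
  have v: "v < d" using Sum.prems by simp
  have code: "code_at P p (compile b a d p)"
    "code_at P q [Const (d + 1) 0, Copy (d + 2) v, Const v 0, Sub (d + 3) d v, Jump_zero (d + 3) (s + 5)]"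
    "code_at P (q + 5) (compile b e (d + 3) (q + 5))"
    "code_at P s [Add (d + 1) (d + 1) (d + 3), Const (d + 3) 1, Add v v (d + 3), Const (d + 3) 0,
        Jump_zero (d + 3) (q + 3), Copy d (d + 1), Copy v (d + 2)]"
    using Sum.prems(4) unfolding compile.simps Let_def q_def[symmetric] s_def[symmetric]
    by (simp_all add: q_def s_def eval_nat_numeral)
  obtain M1 where M1: "run P (time A a \<rho>) (Config p M u w) = Config q M1 u (w @ out A a \<rho>)"
    "M1 d = val A a \<rho>" "\<And>r. r < d \<or> b \<le> r \<Longrightarrow> M1 r = M r"
    using Sum.IH(1)[of d p M \<rho> w] Sum.prems by (auto simp: q_def)
  let ?L = "val A a \<rho>"
  define M2 where "M2 = M1(d + 1 := 0, d + 2 := M v, v := 0)"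
  have init: "run P 3 (Config q M1 u (w @ out A a \<rho>)) = Config (q + 3) M2 u (w @ out A a \<rho>)"
    using code(2) M1(3)[of v] v by (simp add: run_Suc numeral_3_eq_3 M2_def)
  \<comment> \<open>The loop invariant at address \<open>q + 3\<close>, proved by induction on the
    remaining rounds: \<open>d\<close> holds the bound, \<open>d + 1\<close> the partial sum,
    \<open>d + 2\<close> the saved variable and \<open>v\<close> the index.\<close>
  have loop: "\<exists>M'. run P (\<Sum>j=j..<?L. time A e (\<rho>(v := j)) + 7) (Config (q + 3) N u w') =
        Config (q + 3) M' u (w' @ concat (map (\<lambda>j. out A e (\<rho>(v := j))) [j..<?L])) \<and>
        M' d = ?L \<and> M' (d + 1) = (\<Sum>j<?L. val A e (\<rho>(v := j))) \<and> M' (d + 2) = M v \<and> M' v = ?L \<and>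
        (\<forall>r. r \<noteq> v \<and> r < d \<or> b \<le> r \<longrightarrow> M' r = M r)"
    if "j \<le> ?L" "N d = ?L" "N (d + 1) = (\<Sum>j<j. val A e (\<rho>(v := j)))" "N (d + 2) = M v" "N v = j"
      "\<forall>r. r \<noteq> v \<and> r < d \<or> b \<le> r \<longrightarrow> N r = M r" for j N w'
    using that
  proof (induction "?L - j" arbitrary: j N w')
    case 0
    then show ?case by auto
  next
    case (Suc l)
    then have j: "j < ?L" by simp
    define N1 where "N1 = N(d + 3 := ?L - j)"
    have 1: "run P 2 (Config (q + 3) N u w') = Config (q + 5) N1 u w'"
      using code(2) Suc.prems v j by (simp add: run_Suc eval_nat_numeral N1_def)
    have "d + 3 + temps e \<le> b" using Sum.prems(3) by simp
    moreover have "N1 r = (\<rho>(v := j)) r" if "r < V" for r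
      using Suc.prems Sum.prems that by (auto simp: N1_def)
    moreover have "N1 (b + c) = A c" for c
      using Suc.prems Sum.prems by (auto simp: N1_def)
    ultimately have "\<exists>N2. run P (time A e (\<rho>(v := j))) (Config (q + 5) N1 u w') =
        Config (q + 5 + code_length e) N2 u (w' @ out A e (\<rho>(v := j))) \<and>
        N2 (d + 3) = val A e (\<rho>(v := j)) \<and> (\<forall>r. r < d + 3 \<or> b \<le> r \<longrightarrow> N2 r = N1 r)"
      using Sum.prems(1,2) code(3) by (intro Sum.IH(2)) auto
    then obtain N2 where N2: "run P (time A e (\<rho>(v := j))) (Config (q + 5) N1 u w') =
        Config s N2 u (w' @ out A e (\<rho>(v := j)))"
      "N2 (d + 3) = val A e (\<rho>(v := j))" "\<And>r. r < d + 3 \<or> b \<le> r \<Longrightarrow> N2 r = N1 r"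
      unfolding s_def by blast
    \<comment> \<open>Register \<open>d + 3\<close> is zero because the backward jump is a
      conditional jump on a cleared register.\<close>
    define N3 where "N3 = N2(d + 1 := N2 (d + 1) + N2 (d + 3), v := Suc j, d + 3 := 0)"
    have N2v: "N2 v = j" using N2(3)[of v] v Suc.prems by (simp add: N1_def)
    then have 2: "run P 5 (Config s N2 u (w' @ out A e (\<rho>(v := j)))) =
        Config (q + 3) N3 u (w' @ out A e (\<rho>(v := j)))"
      using code(4) v by (simp add: run_Suc eval_nat_numeral N3_def fun_upd_twist)
    have N3: "N3 d = ?L" "N3 (d + 2) = M v" "N3 v = Suc j"
      using v Suc.prems N2 by (auto simp: N3_def N1_def)
    have N31: "N3 (d + 1) = (\<Sum>j<Suc j. val A e (\<rho>(v := j)))"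
      using v Suc.prems N2 by (auto simp: N3_def N1_def)
    have N3r: "\<forall>r. r \<noteq> v \<and> r < d \<or> b \<le> r \<longrightarrow> N3 r = M r"
      using v Suc.prems Sum.prems N2 by (auto simp: N3_def N1_def)
    have "l = ?L - Suc j" "Suc j \<le> ?L" using Suc.hyps j by auto
    from Suc.hyps(1)[OF this N3(1) N31 N3(2,3) N3r, of "w' @ out A e (\<rho>(v := j))"]
    obtain M' where M': "run P (\<Sum>j=Suc j..<?L. time A e (\<rho>(v := j)) + 7) (Config (q + 3) N3 u (w' @ out A e (\<rho>(v := j)))) =
        Config (q + 3) M' u ((w' @ out A e (\<rho>(v := j))) @ concat (map (\<lambda>j. out A e (\<rho>(v := j))) [Suc j..<?L]))"
        "M' d = ?L" "M' (d + 1) = (\<Sum>j<?L. val A e (\<rho>(v := j)))" "M' (d + 2) = M v" "M' v = ?L"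
        "\<forall>r. r \<noteq> v \<and> r < d \<or> b \<le> r \<longrightarrow> M' r = M r" by blast
    have t: "(\<Sum>j=j..<?L. time A e (\<rho>(v := j)) + 7) =
        2 + time A e (\<rho>(v := j)) + 5 + (\<Sum>j=Suc j..<?L. time A e (\<rho>(v := j)) + 7)"
      using j by (simp add: sum.atLeast_Suc_lessThan)
    show ?case
      unfolding t run_add 1 N2(1) 2 M'(1)
      using M'(2-) j by (auto simp: upt_conv_Cons)
  qed
  obtain M3 where M3: "run P (\<Sum>j=0..<?L. time A e (\<rho>(v := j)) + 7) (Config (q + 3) M2 u (w @ out A a \<rho>)) =
        Config (q + 3) M3 u ((w @ out A a \<rho>) @ concat (map (\<lambda>j. out A e (\<rho>(v := j))) [0..<?L]))"
        "M3 d = ?L" "M3 (d + 1) = (\<Sum>j<?L. val A e (\<rho>(v := j)))" "M3 (d + 2) = M v" "M3 v = ?L"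
        "\<forall>r. r \<noteq> v \<and> r < d \<or> b \<le> r \<longrightarrow> M3 r = M r"
    using loop[of 0 M2 "w @ out A a \<rho>"] M1(2,3) v Sum.prems(3) by (auto simp: M2_def)
  \<comment> \<open>On exit the bound minus the index, computed in \<open>d + 3\<close>, is
    0.\<close>
  define M4 where "M4 = M3(d + 3 := 0, d := M3 (d + 1), v := M v)"
  have fin: "run P 4 (Config (q + 3) M3 u w'') = Config (p + code_length (Sum v a e)) M4 u w''" for w''
    using code(2,4) M3 v by (simp add: run_Suc eval_nat_numeral M4_def fun_upd_twist q_def s_def)
  have "run P (time A a \<rho> + 3 + (\<Sum>j=0..<?L. time A e (\<rho>(v := j)) + 7) + 4) (Config p M u w) =
      Config (p + code_length (Sum v a e)) M4 u (w @ out A (Sum v a e) \<rho>)"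
    unfolding run_add M1(1) init M3(1) fin by simp
  moreover have "M4 d = val A (Sum v a e) \<rho>" using M3(3) v by (simp add: M4_def)
  moreover have "\<forall>r. r < d \<or> b \<le> r \<longrightarrow> M4 r = M r" using M3(6) v Sum.prems(3) by (auto simp: M4_def)
  ultimately show ?case by (auto simp: lessThan_atLeast0)
qed


section \<open>Loading the input\<close>

text \<open>The end of the input shows as the value 2 of \<open>Read\<close>: after subtraction of
  one, only this value stays nonzero. Register \<open>V + 1\<close> supplies the constant 1. The
  jumps are absolute, so the 17 instructions belong at address 0 and the program follows at
  17.\<close>

definition loader :: "nat \<Rightarrow> nat \<Rightarrow> instr list" where
  "loader V b =
    [Const (V + 1) 1,
     Read V, Jump_zero V 6, Add 1 1 (V + 1), Const V 0, Jump_zero V 1,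
     Const (V + 2) b,
     Read V, Sub (V + 3) V (V + 1), Jump_zero (V + 3) 12, Const V 0, Jump_zero V 17,
     Store (V + 2) V, Add (V + 2) (V + 2) (V + 1), Add 0 0 (V + 1), Const V 0, Jump_zero V 7]"

text \<open>The value 0 beyond the word agrees with the registers that the loader never
  writes.\<close>

definition cells :: "bool list \<Rightarrow> nat \<Rightarrow> nat" where
  "cells x p = of_bool (p < length x \<and> x ! p)"

text \<open>
  Variable 0 holds the length of the input word and variable 1 the parameter.
\<close>

definition input_env :: "bool list \<Rightarrow> nat \<Rightarrow> nat \<Rightarrow> nat" where
  "input_env x k = (\<lambda>_. 0)(0 := length x, 1 := k)"

lemma load_parameter:
  assumes code: "code_at P 0 (loader V b)" and V: "2 \<le> V" and M: "M (V + 1) = 1"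
  shows "\<exists>M'. run P (5 * k + 2) (Config 1 M (enc_nat k @ x) w) = Config 6 M' x w \<and>
    M' 1 = M 1 + k \<and> (\<forall>r. r \<noteq> 1 \<and> r \<noteq> V \<longrightarrow> M' r = M r)"
  using M
proof (induction k arbitrary: M)
  case 0
  then show ?case using code V by (auto simp: run_Suc eval_nat_numeral loader_def enc_nat_def)
next
  case (Suc k)
  define N where "N = M(1 := Suc (M 1), V := 0)"
  have 1: "run P 5 (Config 1 M (enc_nat (Suc k) @ x) w) = Config 1 N (enc_nat k @ x) w"
    using code V Suc.prems by (auto simp: run_Suc eval_nat_numeral loader_def enc_nat_def N_def fun_upd_twist)
  have "N (V + 1) = 1" using Suc.prems V by (simp add: N_def)
  from Suc.IH[of N, OF this] obtain M' where M': "run P (5 * k + 2) (Config 1 N (enc_nat k @ x) w) = Config 6 M' x w"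
    "M' 1 = N 1 + k" "\<forall>r. r \<noteq> 1 \<and> r \<noteq> V \<longrightarrow> M' r = N r" by blast
  have t: "5 * Suc k + 2 = 5 + (5 * k + 2)" by simp
  show ?case
    unfolding t using run_trans[OF 1 M'(1)] M'(2,3) V by (intro exI[of _ M']) (auto simp: N_def)
qed

text \<open>Register 0 is both the count of bits read and the offset of the next cell. The induction
  on the word therefore needs an arbitrary starting value \<open>M 0\<close>.\<close>

lemma load_word:
  assumes code: "code_at P 0 (loader V b)" and V: "2 \<le> V" and b: "V + 4 \<le> b"
    and M: "M (V + 1) = 1" "M (V + 2) = b + M 0"
  shows "\<exists>M'. run P (8 * length x + 5) (Config 7 M x w) = Config 17 M' [] w \<and>
    M' 0 = M 0 + length x \<and> (\<forall>r. 0 < r \<and> r < V \<longrightarrow> M' r = M r) \<and>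
    (\<forall>a. M' (b + a) = (if M 0 \<le> a \<and> a < M 0 + length x then of_bool (x ! (a - M 0)) else M (b + a)))"
  using M
proof (induction x arbitrary: M)
  case Nil
  then show ?case using code V b by (auto simp: run_Suc eval_nat_numeral loader_def)
next
  case (Cons c x)
  define N where "N = M(V := 0, V + 3 := 0, b + M 0 := of_bool c, V + 2 := Suc (b + M 0), 0 := Suc (M 0))"
  have 1: "run P 8 (Config 7 M (c # x) w) = Config 7 N x w"
    using code V b Cons.prems
    by (auto simp: run_Suc eval_nat_numeral loader_def N_def fun_eq_iff of_bool_def)
  have "N (V + 1) = 1" "N (V + 2) = b + N 0" using Cons.prems V b by (auto simp: N_def)
  from Cons.IH[of N, OF this] obtain M' where M': "run P (8 * length x + 5) (Config 7 N x w) = Config 17 M' [] w"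
    "M' 0 = N 0 + length x" "\<forall>r. 0 < r \<and> r < V \<longrightarrow> M' r = N r"
    "\<forall>a. M' (b + a) = (if N 0 \<le> a \<and> a < N 0 + length x then of_bool (x ! (a - N 0)) else N (b + a))"
    by blast
  have t: "8 * length (c # x) + 5 = 8 + (8 * length x + 5)" by simp
  have "\<forall>a. M' (b + a) = (if M 0 \<le> a \<and> a < M 0 + length (c # x) then of_bool ((c # x) ! (a - M 0)) else M (b + a))"
  proof
    fix a
    show "M' (b + a) = (if M 0 \<le> a \<and> a < M 0 + length (c # x) then of_bool ((c # x) ! (a - M 0)) else M (b + a))"
      using b V by (cases "a = M 0") (auto simp: M'(4) N_def nth_Cons' Suc_diff_le)
  qed
  then show ?case
    unfolding t using run_trans[OF 1 M'(1)] M'(2,3) V b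
    by (intro exI[of _ M']) (auto simp: N_def simp del: length_Cons)
qed

lemma halts_within_mono:
  assumes "halts_within P u v t" "t \<le> t'"
  shows "halts_within P u v t'"
proof -
  define c where "c = (ram_step P ^^ t) (Config 0 (\<lambda>_. 0) u [])"
  have c: "halted P c" "outp c = v" using assms(1) by (simp_all add: halts_within_def c_def Let_def)
  have "(ram_step P ^^ s) c = c" for s
    using c(1) by (induction s) (simp_all add: ram_step_def)
  moreover obtain s where "t' = s + t" using assms(2) by (metis le_add_diff_inverse2)
  ultimately have "(ram_step P ^^ t') (Config 0 (\<lambda>_. 0) u []) = c" by (simp add: funpow_add c_def)
  then show ?thesis using c by (simp add: halts_within_def)
qed

lemma prog_runs_polynomially:
  "\<exists>P c. \<forall>x k. halts_within P (enc_nat k @ x) (out (cells x) e (input_env x k)) ((k + length x + 2) ^ c)"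
proof -
  obtain V0 where "vars_below V0 e" using ex_vars_below by blast
  \<comment> \<open>Registers 0 and 1 are taken by the word length and the parameter, hence
    \<open>2 \<le> V\<close>.\<close>
  then obtain V where V: "vars_below V e" "2 \<le> V" using vars_below_mono[of V0 e "V0 + 2"] by auto
  obtain c where c: "poly_bounded e c" using ex_poly_bounded by blast
  \<comment> \<open>Beyond the registers \<open>V\<close> to \<open>V + 3\<close> of the loader and
    beyond the temporaries of the program, which start at \<open>V\<close> as well.\<close>
  define b where "b = V + 4 + temps e"
  define P where "P = loader V b @ compile b e V 17"
  have len_loader: "length (loader V b) = 17" by (simp add: loader_def)
  have code: "code_at P 0 (loader V b)" "code_at P 17 (compile b e V 17)"
  proof -
    have "code_at P 0 P" by (simp add: code_at_def)
    then have "code_at P 0 (loader V b @ compile b e V 17)" unfolding P_def .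
    then show "code_at P 0 (loader V b)" "code_at P 17 (compile b e V 17)"
      unfolding code_at_append by (auto simp: len_loader)
  qed
  have len: "length P = 17 + code_length e" by (simp add: P_def len_loader)
  have "halts_within P (enc_nat k @ x) (out (cells x) e (input_env x k)) ((k + length x + 2) ^ (c + 6))" for x k
  proof -
    let ?M = "(\<lambda>_. 0) :: nat \<Rightarrow> nat"
    have 1: "run P 1 (Config 0 ?M (enc_nat k @ x) []) = Config 1 (?M(V + 1 := 1)) (enc_nat k @ x) []"
      using code(1) by (simp add: run_Suc loader_def)
    obtain M1 where M1: "run P (5 * k + 2) (Config 1 (?M(V + 1 := 1)) (enc_nat k @ x) []) = Config 6 M1 x []"
      "M1 1 = k" "\<forall>r. r \<noteq> 1 \<and> r \<noteq> V \<longrightarrow> M1 r = (?M(V + 1 := 1)) r"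
      using load_parameter[OF code(1) V(2), of "?M(V + 1 := 1)" k x "[]"] V(2) by auto
    have 2: "run P 1 (Config 6 M1 x []) = Config 7 (M1(V + 2 := b)) x []"
      using code(1) by (simp add: run_Suc loader_def eval_nat_numeral)
    have "V + 4 \<le> b" by (simp add: b_def)
    from load_word[OF code(1) V(2) this, of "M1(V + 2 := b)" x "[]"]
    obtain M2 where M2: "run P (8 * length x + 5) (Config 7 (M1(V + 2 := b)) x []) = Config 17 M2 [] []"
      "M2 0 = length x" "\<forall>r. 0 < r \<and> r < V \<longrightarrow> M2 r = M1 r" "\<forall>a. M2 (b + a) = cells x a"
      using M1 V(2) by (auto simp: b_def cells_def)
    have "M2 r = input_env x k r" if "r < V" for r
      using that M2(2,3) M1(2,3) by (auto simp: input_env_def)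
    then obtain M3 where M3: "run P (time (cells x) e (input_env x k)) (Config 17 M2 [] []) =
        Config (17 + code_length e) M3 [] (out (cells x) e (input_env x k))"
      using compile_correct[OF V(1) le_refl _ code(2), of M2 "input_env x k" "cells x" "[]" "[]"] M2(4)
      by (auto simp: b_def)
    define t where "t = 1 + (5 * k + 2) + 1 + (8 * length x + 5) + time (cells x) e (input_env x k)"
    have fin: "run P t (Config 0 ?M (enc_nat k @ x) []) =
        Config (17 + code_length e) M3 [] (out (cells x) e (input_env x k))"
      unfolding t_def by (rule run_trans[OF run_trans[OF run_trans[OF run_trans[OF 1 M1(1)] 2] M2(1)] M3])
    define X where "X = k + length x + 2"
    have X: "2 \<le> X" by (simp add: X_def)
    have time: "time (cells x) e (input_env x k) \<le> X ^ (c + 5)"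
      by (rule poly_boundedD(2)[OF c]) (auto simp: input_env_def cells_def X_def)
    have "1 + (5 * k + 2) + 1 + (8 * length x + 5) \<le> 2 ^ 3 * X" by (simp add: X_def)
    also have "\<dots> \<le> X ^ 3 * X" using X by (intro mult_le_mono power_mono) auto
    also have "\<dots> = X ^ Suc 3" by (rule power_Suc2[symmetric])
    finally have "1 + (5 * k + 2) + 1 + (8 * length x + 5) \<le> X ^ (c + 5)"
      using X by (rule le_power_trans) simp
    from add_le_power_Suc[OF this time X] have "t \<le> X ^ Suc (c + 5)" unfolding t_def .
    also have "X ^ Suc (c + 5) = X ^ (c + 6)" by (rule arg_cong[of _ _ "power X"]) simp
    finally have "t \<le> X ^ (c + 6)" .
    moreover have "halts_within P (enc_nat k @ x) (out (cells x) e (input_env x k)) t"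
      using fin by (simp add: halts_within_def run_def[symmetric] halted_def len)
    ultimately have "halts_within P (enc_nat k @ x) (out (cells x) e (input_env x k)) (X ^ (c + 6))"
      by (rule halts_within_mono[rotated])
    then show ?thesis unfolding X_def .
  qed
  then show ?thesis by blast
qed

section \<open>Recognition of encoded instances by counting zeros\<close>

section \<open>Parsing\<close>

text \<open>
  The unary number at position \<open>z\<close> of a sequence of encoded numbers is the number of ones preceded
  by exactly \<open>z\<close> zeros.  This makes parsing a bounded sum.
\<close>

fun nth_number :: "bool list \<Rightarrow> nat \<Rightarrow> nat" where
  "nth_number [] z = 0"
| "nth_number (b # w) z = (if b then of_bool (z = 0) + nth_number w z
     else case z of 0 \<Rightarrow> 0 | Suc z' \<Rightarrow> nth_number w z')"

definition zeros :: "bool list \<Rightarrow> nat" where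
  "zeros w = length (filter Not w)"

lemma zeros_simps [simp]:
  "zeros [] = 0" "zeros (b # w) = of_bool (\<not> b) + zeros w" "zeros (v @ w) = zeros v + zeros w"
  "zeros (enc_nat a) = 1" "zeros (replicate a True) = 0"
  by (simp_all add: zeros_def enc_nat_def)

lemma enc_nat_0: "enc_nat 0 = [False]" and enc_nat_Suc: "enc_nat (Suc a) = True # enc_nat a"
  by (simp_all add: enc_nat_def)

lemma nth_number_enc_nat [simp]:
  "nth_number (enc_nat a @ w) 0 = a" "nth_number (enc_nat a @ w) (Suc z) = nth_number w z"
  by (induction a) (simp_all add: enc_nat_0 enc_nat_Suc)

lemma nth_number_concat [simp]:
  "nth_number (concat (map enc_nat ns)) z = (if z < length ns then ns ! z else 0)"
  by (induction ns arbitrary: z) (simp, case_tac z, auto)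

lemma zeros_concat [simp]: "zeros (concat (map enc_nat ns)) = length ns"
  by (induction ns) auto

text \<open>Any word is a sequence of terminated unary numbers followed by a remainder of ones.
  Well-formedness can thus be tested by counting alone.\<close>

lemma nth_number_decomposition:
  "w = concat (map (\<lambda>i. enc_nat (nth_number w i)) [0..<zeros w]) @
     replicate (nth_number w (zeros w)) True"
proof (induction w)
  case (Cons b w)
  have shift: "map g [0..<Suc a] = g 0 # map (\<lambda>i. g (Suc i)) [0..<a]" for g :: "nat \<Rightarrow> bool list" and a
    by (simp add: upt_conv_Cons map_Suc_upt[symmetric] del: upt_Suc)
  show ?case
  proof (cases b)
    case False
    then show ?thesis using Cons by (simp add: shift enc_nat_0 del: upt_Suc)
  next
    case True
    show ?thesis
    proof (cases "zeros w")
      case 0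
      then show ?thesis using True Cons by simp
    next
      case (Suc a)
      then show ?thesis using True Cons by (simp add: shift enc_nat_Suc del: upt_Suc)
    qed
  qed
qed simp

text \<open>A one belongs to block \<open>z\<close> iff \<open>z\<close> zeros precede it. The two
  nested sums are the form in which a program can compute this.\<close>

lemma sum_eq_nth_number:
  "(\<Sum>p<length w. of_bool (w ! p \<and> (\<Sum>q<p. of_bool (\<not> w ! q)) = z)) = nth_number w z"
proof (induction w arbitrary: z)
  case (Cons b w)
  have "(\<Sum>p<length (b # w). of_bool ((b # w) ! p \<and> (\<Sum>q<p. of_bool (\<not> (b # w) ! q)) = z)) =
      of_bool (b \<and> z = 0) + (\<Sum>p<length w. of_bool (w ! p \<and> of_bool (\<not> b) + (\<Sum>q<p. of_bool (\<not> w ! q)) = z))"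
    by (simp add: sum.lessThan_Suc_shift del: sum.lessThan_Suc sum_of_bool_eq)
  also have "\<dots> = nth_number (b # w) z"
  proof (cases b)
    case True
    then show ?thesis using Cons[of z] by (simp del: sum_of_bool_eq)
  next
    case False
    show ?thesis
    proof (cases z)
      case (Suc z')
      then show ?thesis using False Cons[of z'] by (simp del: sum_of_bool_eq)
    qed (use False in simp)
  qed
  finally show ?case .
qed simp

lemma sum_eq_zeros: "(\<Sum>p<length w. of_bool (\<not> w ! p)) = zeros w"
  by (induction w) (simp_all add: sum.lessThan_Suc_shift del: sum.lessThan_Suc sum_of_bool_eq)

definition num_verts :: "bool list \<Rightarrow> nat" where
  "num_verts x = nth_number x 0"

definition num_edges :: "bool list \<Rightarrow> nat" where
  "num_edges x = nth_number x 1"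

text \<open>The 2 accounts for the zeros that terminate the two leading numbers.\<close>

definition matrix_start :: "bool list \<Rightarrow> nat" where
  "matrix_start x = num_verts x + num_edges x + 2"

definition tail :: "bool list \<Rightarrow> bool list" where
  "tail x = drop (matrix_start x + num_edges x * num_verts x) x"

text \<open>Because of the bound on \<open>y\<close>, the parsed edges are sets of vertices for
  every word.\<close>

definition edge_of :: "bool list \<Rightarrow> nat \<Rightarrow> nat set" where
  "edge_of x i = {y. y < num_verts x \<and> cells x (matrix_start x + (i * num_verts x + y)) \<noteq> 0}"

definition corr_of :: "bool list \<Rightarrow> nat \<Rightarrow> nat" where
  "corr_of x v = nth_number (tail x) v"

definition fun_of :: "bool list \<Rightarrow> nat \<Rightarrow> nat" where
  "fun_of x v = nth_number (tail x) (num_verts x + v)"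

text \<open>Two zeros mean that both leading numbers are terminated. The last condition excludes
  ones after the final terminator, so nothing may trail the encoding.\<close>

definition well_formed :: "bool list \<Rightarrow> bool" where
  "well_formed x \<longleftrightarrow> 2 \<le> zeros x \<and> matrix_start x + num_edges x * num_verts x \<le> length x \<and>
     zeros (tail x) = 2 * num_verts x \<and> nth_number (tail x) (2 * num_verts x) = 0"

lemma concat_map_rows:
  "concat (map (\<lambda>i. map (\<lambda>y. P (i * n + y)) [0..<n]) [0..<m]) = map P [0..<m * (n::nat)]"
proof (induction m)
  case (Suc m)
  have "[0..<Suc m * n] = [0..<m * n] @ map (\<lambda>y. m * n + y) [0..<n]"
    using upt_add_eq_append[of 0 "m * n" n] map_add_upt[of "m * n" n] by (simp add: add.commute)
  then show ?case using Suc by (simp del: upt_Suc add: upt_Suc_append)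
qed simp

lemma well_formed_enc_instance: "well_formed (enc_instance n m s \<tau> f)"
proof -
  let ?x = "enc_instance n m s \<tau> f"
  let ?t = "concat (map enc_nat (map \<tau> [0..<n] @ map f [0..<n]))"
  let ?r = "concat (map (\<lambda>i. map (\<lambda>x. x \<in> s i) [0..<n]) [0..<m])"
  have x: "?x = enc_nat n @ enc_nat m @ ?r @ ?t"
    by (simp add: enc_instance_def comp_def)
  have n: "num_verts ?x = n" unfolding num_verts_def x by simp
  have m: "num_edges ?x = m" unfolding num_edges_def x One_nat_def by simp
  have len: "length ?r = m * n" by (simp add: length_concat comp_def sum_list_triv)
  have "length (enc_nat n @ enc_nat m @ ?r) = matrix_start ?x + m * n"
    unfolding matrix_start_def n m length_append len by (simp add: enc_nat_def)
  moreover have "?x = (enc_nat n @ enc_nat m @ ?r) @ ?t" using x by simp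
  ultimately have "tail ?x = ?t" "matrix_start ?x + m * n \<le> length ?x"
    unfolding tail_def n m by (metis append_eq_conv_conj, metis length_append le_add1)
  moreover have "2 \<le> zeros ?x" unfolding x by simp
  moreover have "zeros ?t = 2 * n" unfolding zeros_concat by simp
  moreover have "nth_number ?t (2 * n) = 0" unfolding nth_number_concat by simp
  ultimately show ?thesis unfolding well_formed_def n m by simp
qed

text \<open>Decomposing \<open>x\<close> gives the two leading numbers, decomposing
  \<open>tail x\<close> gives the \<open>2 * n\<close> numbers at the end with an empty remainder.
  The matrix between them has no delimiters, but its length is known.\<close>

lemma well_formed_imp_enc_instance:
  assumes "well_formed x"
  shows "x = enc_instance (num_verts x) (num_edges x) (edge_of x) (corr_of x) (fun_of x)"
proof -
  let ?n = "num_verts x" and ?m = "num_edges x"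
  have "[0..<zeros x] = 0 # 1 # [2..<zeros x]"
    using assms by (simp add: well_formed_def upt_conv_Cons numeral_2_eq_2)
  with nth_number_decomposition[of x] obtain rest where "x = enc_nat ?n @ enc_nat ?m @ rest"
    by (simp add: num_verts_def num_edges_def)
  then obtain pre where x: "x = pre @ rest" and pre: "pre = enc_nat ?n @ enc_nat ?m" by simp
  have start: "matrix_start x = length pre"
    unfolding pre by (simp add: matrix_start_def enc_nat_def)
  have tail: "tail x = drop (?m * ?n) rest"
    unfolding tail_def start using x by (metis append_eq_conv_conj drop_drop add.commute)
  have len: "?m * ?n \<le> length rest"
    using assms arg_cong[OF x, of length] unfolding well_formed_def start by simp
  have cells: "cells x (matrix_start x + p) \<noteq> 0 \<longleftrightarrow> rest ! p" if "p < ?m * ?n" for p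
  proof -
    have "x ! (length pre + p) = rest ! p" using x by (metis nth_append_length_plus)
    then show ?thesis using that len arg_cong[OF x, of length] by (simp add: cells_def start)
  qed
  have "take (?m * ?n) rest = map (\<lambda>p. cells x (matrix_start x + p) \<noteq> 0) [0..<?m * ?n]"
    using len cells by (intro nth_equalityI) auto
  also have "\<dots> = concat (map (\<lambda>i. map (\<lambda>y. cells x (matrix_start x + (i * ?n + y)) \<noteq> 0) [0..<?n]) [0..<?m])"
    by (rule concat_map_rows[symmetric])
  also have "\<dots> = concat (map (\<lambda>i. map (\<lambda>y. y \<in> edge_of x i) [0..<?n]) [0..<?m])"
    by (intro arg_cong[of _ _ concat] map_cong refl) (simp add: edge_of_def)
  finally have rows: "take (?m * ?n) rest = \<dots>" .
  have "[0..<2 * ?n] = [0..<?n] @ map (\<lambda>v. ?n + v) [0..<?n]"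
    using upt_add_eq_append[of 0 ?n ?n] map_add_upt[of ?n ?n] by (simp add: add.commute mult_2)
  with nth_number_decomposition[of "tail x"] assms
  have "tail x = concat (map (\<lambda>v. enc_nat (corr_of x v)) [0..<?n]) @ concat (map (\<lambda>v. enc_nat (fun_of x v)) [0..<?n])"
    by (simp add: well_formed_def corr_of_def fun_of_def comp_def)
  with rows tail have "rest = concat (map (\<lambda>i. map (\<lambda>y. y \<in> edge_of x i) [0..<?n]) [0..<?m]) @
      concat (map (\<lambda>v. enc_nat (corr_of x v)) [0..<?n]) @ concat (map (\<lambda>v. enc_nat (fun_of x v)) [0..<?n])"
    by (metis append_take_drop_id)
  with x pre show ?thesis unfolding enc_instance_def by simp
qed

text \<open>The correspondence condition searches for \<open>j\<close> because programs test
  incidence only between values of variables. The parameter must equal the weight, since other pairs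
  are not in the problem.\<close>

definition valid_instance :: "bool list \<Rightarrow> nat \<Rightarrow> bool" where
  "valid_instance x k \<longleftrightarrow> well_formed x \<and>
     (\<forall>v<num_verts x. \<exists>j<num_edges x. corr_of x v = j \<and> v \<in> edge_of x j) \<and>
     (\<forall>v<num_verts x. fun_of x v \<le> 2) \<and> (\<Sum>v<num_verts x. fun_of x v) = k"

abbreviation hypergraph_of :: "bool list \<Rightarrow> (nat, nat) hypergraph" where
  "hypergraph_of x \<equiv> nat_hypergraph (num_verts x) (num_edges x) (edge_of x)"

lemma valid_instance_iff:
  "valid_instance x k \<longleftrightarrow> well_formed x \<and> is_hypergraph (hypergraph_of x) \<and>
     correspondence (hypergraph_of x) (corr_of x) \<and>
     fun_of x \<in> verts (hypergraph_of x) \<rightarrow> {0, 1, 2} \<and> weight (hypergraph_of x) (fun_of x) = k"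
proof -
  have "a \<le> 2 \<longleftrightarrow> a \<in> {0, 1, 2}" for a :: nat by auto
  then have "fun_of x \<in> verts (hypergraph_of x) \<rightarrow> {0, 1, 2} \<longleftrightarrow> (\<forall>v<num_verts x. fun_of x v \<le> 2)"
    unfolding Pi_iff by (simp add: nat_hypergraph_def Ball_def)
  moreover have "is_hypergraph (hypergraph_of x)"
    by (auto simp: is_hypergraph_def nat_hypergraph_def edge_of_def)
  ultimately show ?thesis
    unfolding valid_instance_def correspondence_def weight_def
    by (auto simp: nat_hypergraph_def)
qed

text \<open>An encoding determines the data only for edges below \<open>m\<close> and vertices below
  \<open>n\<close>. This allows the original data to be exchanged for the parsed ones.\<close>

lemma extension_rhf_yes_cong:
  assumes s: "\<And>i. i < m \<Longrightarrow> s i = s' i" and \<tau>: "\<And>v. v < n \<Longrightarrow> \<tau> v = \<tau>' v"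
    and f: "\<And>v. v < n \<Longrightarrow> f v = f' v"
  shows "extension_rhf_yes (nat_hypergraph n m s) \<tau> f \<longleftrightarrow> extension_rhf_yes (nat_hypergraph n m s') \<tau>' f'"
proof -
  have "(\<exists>v\<in>{..<n}. \<tau> v = i \<and> g v = 1) \<longleftrightarrow> (\<exists>v\<in>{..<n}. \<tau>' v = i \<and> g v = 1)" for i and g :: "nat \<Rightarrow> nat"
    using \<tau> by (intro bex_cong) auto
  then have "rhf (nat_hypergraph n m s) \<tau> g = rhf (nat_hypergraph n m s') \<tau>' g" for g
    using s by (simp add: rhf_def nat_hypergraph_def Ball_def)
  moreover have verts: "verts (nat_hypergraph n m s) = verts (nat_hypergraph n m s')"
    by (simp add: nat_hypergraph_def)
  moreover have "fun_le (nat_hypergraph n m s) = fun_le (nat_hypergraph n m s')"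
    "fun_le (nat_hypergraph n m s) f = fun_le (nat_hypergraph n m s') f'"
    using f by (auto simp: fun_le_def nat_hypergraph_def fun_eq_iff)
  ultimately show ?thesis
    unfolding extension_rhf_yes_def minimal_rhf_def by (simp add: verts)
qed

lemma extension_roman_hitting_function_iff:
  "(x, k) \<in> extension_roman_hitting_function \<longleftrightarrow>
     valid_instance x k \<and> extension_rhf_yes (hypergraph_of x) (corr_of x) (fun_of x)"
proof
  assume "valid_instance x k \<and> extension_rhf_yes (hypergraph_of x) (corr_of x) (fun_of x)"
  then show "(x, k) \<in> extension_roman_hitting_function"
    using well_formed_imp_enc_instance[of x]
    unfolding valid_instance_iff extension_roman_hitting_function_def by blast
next
  assume "(x, k) \<in> extension_roman_hitting_function"
  then obtain n m s \<tau> f where x: "x = enc_instance n m s \<tau> f" "k = weight (nat_hypergraph n m s) f"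
    and inst: "is_hypergraph (nat_hypergraph n m s)" "correspondence (nat_hypergraph n m s) \<tau>"
      "f \<in> verts (nat_hypergraph n m s) \<rightarrow> {0, 1, 2}" "extension_rhf_yes (nat_hypergraph n m s) \<tau> f"
    unfolding extension_roman_hitting_function_def by blast
  have wf: "well_formed x" unfolding x(1) by (rule well_formed_enc_instance)
  have "enc_instance n m s \<tau> f = enc_instance (num_verts x) (num_edges x) (edge_of x) (corr_of x) (fun_of x)"
    using well_formed_imp_enc_instance[OF wf] x(1) by simp
  then have eq: "n = num_verts x" "m = num_edges x"
    and eq_s: "\<And>i v. i < m \<Longrightarrow> v < n \<Longrightarrow> v \<in> s i \<longleftrightarrow> v \<in> edge_of x i"
    and eq_\<tau>: "\<And>v. v < n \<Longrightarrow> \<tau> v = corr_of x v" and eq_f: "\<And>v. v < n \<Longrightarrow> f v = fun_of x v"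
    unfolding enc_instance_inject by blast+
  have s: "s i = edge_of x i" if "i < m" for i
    using inst(1) that eq_s[OF that] unfolding is_hypergraph_def eq
    by (auto simp: nat_hypergraph_def edge_of_def)
  have "extension_rhf_yes (nat_hypergraph n m (edge_of x)) (corr_of x) (fun_of x)"
    using inst(4) extension_rhf_yes_cong[of m s "edge_of x" n \<tau> "corr_of x" f "fun_of x"] s eq_\<tau> eq_f
    by simp
  moreover have "valid_instance x k"
    unfolding valid_instance_def eq[symmetric]
  proof (intro conjI allI impI)
    fix v assume v: "v < n"
    have "\<tau> v < m" "v \<in> s (\<tau> v)"
      using inst(2) v by (auto simp: correspondence_def nat_hypergraph_def)
    then show "\<exists>j<m. corr_of x v = j \<and> v \<in> edge_of x j" using s eq_\<tau>[OF v] by auto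
    have "f v \<in> {0, 1, 2}" using funcset_mem[OF inst(3)] v by (simp add: nat_hypergraph_def)
    then show "fun_of x v \<le> 2" using eq_f[OF v] by auto
  next
    show "(\<Sum>v<n. fun_of x v) = k" using eq_f by (simp add: x(2) weight_def nat_hypergraph_def)
  qed (fact wf)
  ultimately show "valid_instance x k \<and> extension_rhf_yes (hypergraph_of x) (corr_of x) (fun_of x)"
    unfolding eq by blast
qed

section \<open>The reduction as a program\<close>

section \<open>Derived constructs\<close>

declare sum_of_bool_eq [simp del]

text \<open>Any nonzero value counts as true; truncated subtraction turns this into the test for
  zero.\<close>

definition Neg :: "prog \<Rightarrow> prog" where
  "Neg a = Minus (Num 1) a"

definition Conj :: "prog \<Rightarrow> prog \<Rightarrow> prog" where
  "Conj a e = Neg (Plus (Neg a) (Neg e))"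

definition Eq :: "prog \<Rightarrow> prog \<Rightarrow> prog" where
  "Eq a e = Neg (Plus (Minus a e) (Minus e a))"

definition All :: "nat \<Rightarrow> prog \<Rightarrow> prog \<Rightarrow> prog" where
  "All v a e = Neg (Sum v a (Neg e))"

text \<open>
  Variable 2 is reserved for the binders of \<open>Times\<close>, \<open>When\<close> and \<open>Unary\<close>, and variables 6 and 7 for the
  binders of \<open>Number\<close> and \<open>Zeros\<close> below; the arguments must not refer to them.
\<close>

definition Times :: "prog \<Rightarrow> prog \<Rightarrow> prog" where
  "Times a e = Sum 2 a e"

definition When :: "prog \<Rightarrow> prog \<Rightarrow> prog" where
  "When a e = Sum 2 (Neg (Neg a)) e"

definition Unary :: "prog \<Rightarrow> prog" where
  "Unary a = Plus (Sum 2 a (Emit True)) (Emit False)"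

definition Wire :: "prog \<Rightarrow> prog" where
  "Wire a = Plus (Emit True) (Unary a)"

lemma val_Neg [simp]: "val A (Neg a) \<rho> = of_bool (val A a \<rho> = 0)"
  by (simp add: Neg_def)

lemma val_macros [simp]:
  "val A (Conj a e) \<rho> = of_bool (val A a \<rho> \<noteq> 0 \<and> val A e \<rho> \<noteq> 0)"
  "val A (Eq a e) \<rho> = of_bool (val A a \<rho> = val A e \<rho>)"
  "val A (All v a e) \<rho> = of_bool (\<forall>j<val A a \<rho>. val A e (\<rho>(v := j)) \<noteq> 0)"
  by (auto simp: Conj_def Eq_def All_def)

lemma concat_map_Nil [simp]: "concat (map (\<lambda>_. []) xs) = []"
  by (induction xs) auto

lemma out_macros [simp]:
  "out A (Neg a) \<rho> = out A a \<rho>"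
  "out A (Conj a e) \<rho> = out A a \<rho> @ out A e \<rho>"
  "out A (Eq a e) \<rho> = out A a \<rho> @ out A e \<rho> @ out A e \<rho> @ out A a \<rho>"
  "out A (All v a e) \<rho> = out A (Sum v a e) \<rho>"
  "out A (Times a e) \<rho> = out A (Sum 2 a e) \<rho>"
  by (auto simp: Neg_def Conj_def Eq_def All_def Times_def)

lemma val_Times: "(\<And>j. val A e (\<rho>(2 := j)) = c) \<Longrightarrow> val A (Times a e) \<rho> = val A a \<rho> * c"
  by (simp add: Times_def)

text \<open>The double negation normalises the condition to 0 or 1, so the loop runs its body at
  most once, with binder 2 set to 0.\<close>

lemma out_When [simp]:
  "out A (When a e) \<rho> = out A a \<rho> @ (if val A a \<rho> = 0 then [] else out A e (\<rho>(2 := 0)))"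
  by (simp add: When_def)

lemma out_Unary [simp]: "out A (Unary a) \<rho> = out A a \<rho> @ enc_nat (val A a \<rho>)"
proof -
  have "concat (map (\<lambda>_. [True]) [0..<l]) = replicate l True" for l
    by (induction l) (auto simp: replicate_append_same)
  then show ?thesis by (simp add: Unary_def enc_nat_def)
qed

lemma out_Wire [simp]: "out A a \<rho> = [] \<Longrightarrow> out A (Wire a) \<rho> = True # enc_nat (val A a \<rho>)"
  by (simp add: Wire_def)

section \<open>Reading off the instance\<close>

definition Number :: "prog \<Rightarrow> prog \<Rightarrow> prog" where
  "Number a z = Sum 6 (Minus (Var 0) a) (Conj (Cell (Plus a (Var 6)))
     (Eq (Sum 7 (Var 6) (Neg (Cell (Plus a (Var 7))))) z))"

definition Zeros :: "prog \<Rightarrow> prog" where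
  "Zeros a = Sum 6 (Minus (Var 0) a) (Neg (Cell (Plus a (Var 6))))"

definition Num_verts :: prog where
  "Num_verts = Number (Num 0) (Num 0)"

definition Num_edges :: prog where
  "Num_edges = Number (Num 0) (Num 1)"

definition Start :: prog where
  "Start = Plus (Plus Num_verts Num_edges) (Num 2)"

definition Tail :: prog where
  "Tail = Plus Start (Times Num_edges Num_verts)"

definition Mem :: "nat \<Rightarrow> nat \<Rightarrow> prog" where
  "Mem y j = Conj (Minus Num_verts (Var y))
     (Cell (Plus Start (Plus (Times (Var j) Num_verts) (Var y))))"

definition Corr :: "nat \<Rightarrow> prog" where
  "Corr v = Number Tail (Var v)"

definition Fun :: "nat \<Rightarrow> prog" where
  "Fun v = Number Tail (Plus Num_verts (Var v))"

definition Valid :: prog where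
  "Valid =
     Conj (Conj (Conj (Minus (Zeros (Num 0)) (Num 1)) (Neg (Minus Tail (Var 0))))
       (Conj (Eq (Zeros Tail) (Plus Num_verts Num_verts)) (Neg (Number Tail (Plus Num_verts Num_verts)))))
     (Conj (All 3 Num_verts (Sum 5 Num_edges (Conj (Eq (Corr 3) (Var 5)) (Mem 3 5))))
       (Conj (All 3 Num_verts (Neg (Minus (Fun 3) (Num 2)))) (Eq (Sum 3 Num_verts (Fun 3)) (Var 1))))"

lemma out_Number [simp]:
  assumes "\<And>\<rho>. out A a \<rho> = []" "\<And>\<rho>. out A z \<rho> = []"
  shows "out A (Number a z) \<rho> = []"
  using assms by (simp add: Number_def)

lemma out_Zeros [simp]:
  assumes "\<And>\<rho>. out A a \<rho> = []"
  shows "out A (Zeros a) \<rho> = []"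
  using assms by (simp add: Zeros_def)

lemma out_parsers [simp]:
  "out A Num_verts \<rho> = []" "out A Num_edges \<rho> = []" "out A Start \<rho> = []" "out A Tail \<rho> = []"
  "out A (Mem y j) \<rho> = []" "out A (Corr v) \<rho> = []" "out A (Fun v) \<rho> = []"
  by (simp_all add: Num_verts_def Num_edges_def Start_def Tail_def Mem_def Corr_def Fun_def)

lemma out_Valid [simp]: "out A Valid \<rho> = []"
  by (simp add: Valid_def)

text \<open>The offset \<open>a\<close> is evaluated under the binders 6 and 7, so its value may
  depend on variable 0 only; \<open>z\<close> stands outside the inner sum and meets binder 6
  alone.\<close>

lemma val_Number:
  assumes \<rho>: "\<rho> 0 = length x"
    and a: "\<And>\<rho>. \<rho> 0 = length x \<Longrightarrow> val (cells x) a \<rho> = c"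
    and z: "\<And>p. val (cells x) z (\<rho>(6 := p)) = d"
  shows "val (cells x) (Number a z) \<rho> = nth_number (drop c x) d"
proof -
  let ?w = "drop c x"
  have cell: "cells x (c + p) = of_bool (?w ! p)" if "p < length x - c" for p
    using that by (simp add: cells_def add.commute less_diff_conv)
  have "val (cells x) (Number a z) \<rho> =
      (\<Sum>p<length x - c. of_bool (cells x (c + p) \<noteq> 0 \<and> (\<Sum>q<p. of_bool (cells x (c + q) = 0)) = d))"
    using \<rho> a z by (simp add: Number_def)
  also have "\<dots> = (\<Sum>p<length ?w. of_bool (?w ! p \<and> (\<Sum>q<p. of_bool (\<not> ?w ! q)) = d))"
  proof (rule sum.cong)
    fix p assume "p \<in> {..<length ?w}"
    then have p: "p < length x - c" by simp
    have "(\<Sum>q<p. of_bool (cells x (c + q) = 0)) = (\<Sum>q<p. of_bool (\<not> ?w ! q) :: nat)"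
      using p by (intro sum.cong) (auto simp: cell)
    then show "of_bool (cells x (c + p) \<noteq> 0 \<and> (\<Sum>q<p. of_bool (cells x (c + q) = 0)) = d) =
        of_bool (?w ! p \<and> (\<Sum>q<p. of_bool (\<not> ?w ! q)) = d)"
      using cell[OF p] by simp
  qed simp
  also have "\<dots> = nth_number ?w d" by (rule sum_eq_nth_number)
  finally show ?thesis .
qed

lemma val_Zeros:
  assumes "\<rho> 0 = length x" and "\<And>\<rho>. \<rho> 0 = length x \<Longrightarrow> val (cells x) a \<rho> = c"
  shows "val (cells x) (Zeros a) \<rho> = zeros (drop c x)"
proof -
  have "val (cells x) (Zeros a) \<rho> = (\<Sum>p<length (drop c x). of_bool (\<not> drop c x ! p))"
    using assms by (auto simp: Zeros_def cells_def intro!: sum.cong)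
  then show ?thesis by (simp only: sum_eq_zeros)
qed

lemma val_Num_verts [simp]: "\<rho> 0 = length x \<Longrightarrow> val (cells x) Num_verts \<rho> = num_verts x"
  unfolding Num_verts_def num_verts_def by (subst val_Number[where c = 0]) auto

lemma val_Num_edges [simp]: "\<rho> 0 = length x \<Longrightarrow> val (cells x) Num_edges \<rho> = num_edges x"
  unfolding Num_edges_def num_edges_def by (subst val_Number[where c = 0]) auto

lemma val_Start [simp]: "\<rho> 0 = length x \<Longrightarrow> val (cells x) Start \<rho> = matrix_start x"
  by (simp add: Start_def matrix_start_def)

lemma val_Tail [simp]:
  "\<rho> 0 = length x \<Longrightarrow> val (cells x) Tail \<rho> = matrix_start x + num_edges x * num_verts x"
  unfolding Tail_def by (simp add: val_Times)

lemma val_Mem [simp]: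
  "\<rho> 0 = length x \<Longrightarrow> y \<noteq> 2 \<Longrightarrow> val (cells x) (Mem y j) \<rho> = of_bool (\<rho> y \<in> edge_of x (\<rho> j))"
  unfolding Mem_def by (auto simp: val_Times edge_of_def)

lemma val_Number_Tail:
  "\<rho> 0 = length x \<Longrightarrow> (\<And>p. val (cells x) z (\<rho>(6 := p)) = d) \<Longrightarrow>
    val (cells x) (Number Tail z) \<rho> = nth_number (tail x) d"
  unfolding tail_def by (rule val_Number) auto

lemma val_Corr [simp]: "\<rho> 0 = length x \<Longrightarrow> v \<noteq> 6 \<Longrightarrow> val (cells x) (Corr v) \<rho> = corr_of x (\<rho> v)"
  unfolding Corr_def corr_of_def by (rule val_Number_Tail) auto

lemma val_Fun [simp]: "\<rho> 0 = length x \<Longrightarrow> v \<noteq> 6 \<Longrightarrow> val (cells x) (Fun v) \<rho> = fun_of x (\<rho> v)"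
  unfolding Fun_def fun_of_def by (rule val_Number_Tail) auto

lemma val_Valid [simp]:
  assumes "\<rho> 0 = length x"
  shows "val (cells x) Valid \<rho> = of_bool (valid_instance x (\<rho> 1))"
proof -
  have z: "val (cells x) (Zeros (Num 0)) \<rho> = zeros x" "val (cells x) (Zeros Tail) \<rho> = zeros (tail x)"
    using val_Zeros[of \<rho> x "Num 0" 0] val_Zeros[of \<rho> x Tail] assms by (simp_all add: tail_def)
  have t: "val (cells x) (Number Tail (Plus Num_verts Num_verts)) \<rho> = nth_number (tail x) (2 * num_verts x)"
    using assms by (intro val_Number_Tail) auto
  have "2 \<le> a \<longleftrightarrow> a - 1 \<noteq> 0" for a :: nat by auto
  then show ?thesis
    using assms unfolding valid_instance_def well_formed_def Valid_def
    by (auto simp: z t)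
qed

section \<open>Writing the circuit\<close>

primrec Emits :: "bool list \<Rightarrow> prog" where
  "Emits [] = Num 0"
| "Emits (b # bs) = Plus (Emit b) (Emits bs)"

lemma out_Emits [simp]: "out A (Emits bs) \<rho> = bs"
  by (induction bs) auto

text \<open>This is \<open>enc_list\<close> without its terminator and hence, unlike
  \<open>enc_list\<close>, distributes over concatenation, just as the output of a loop
  does.\<close>

definition enc_wires :: "nat list \<Rightarrow> bool list" where
  "enc_wires us = concat (map (\<lambda>u. True # enc_nat u) us)"

lemma enc_wires_simps:
  "enc_wires [] = []" "enc_wires (u # us) = True # enc_nat u @ enc_wires us"
  "enc_wires (us @ vs) = enc_wires us @ enc_wires vs"
  "enc_wires (concat (map g xs)) = concat (map (\<lambda>y. enc_wires (g y)) xs)"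
  by (simp_all add: enc_wires_def) (induction xs; simp)

lemma enc_list_enc_nat: "enc_list enc_nat us = enc_wires us @ [False]"
  by (simp add: enc_list_def enc_wires_def)

definition Size :: prog where
  "Size = Times Num_verts Num_edges"

definition Pair_index :: "nat \<Rightarrow> nat \<Rightarrow> prog" where
  "Pair_index y j = Plus (Times (Var y) Num_edges) (Var j)"

text \<open>The start of block \<open>c\<close> after inputs and negations: 0 for eligibility, 1 for
  keeping a one, 2 for the disjunction of both, 3 for the choice of an edge, 4 for covering.\<close>

definition Shift :: "nat \<Rightarrow> prog" where
  "Shift c = Plus (Plus Size Size) (Times (Num c) Num_verts)"

text \<open>The loops and tests follow those of \<open>conflict_list\<close> in the same order, so
  that the outputs agree bit by bit. Variables 3 and 4 stand for \<open>x\<close> and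
  \<open>y\<close>, variable 5 for an edge; addition serves as disjunction.\<close>

definition Conflict_list :: prog where
  "Conflict_list = Sum 3 Num_verts (Sum 5 Num_edges
     (When (Plus (Conj (Neg (Eq (Var 3) (Var 4))) (Mem 4 5)) (Conj (Eq (Var 3) (Var 4)) (Eq (Var 5) (Corr 4))))
       (Wire (Plus Size (Pair_index 3 5)))))"

definition Keep_one_list :: prog where
  "Keep_one_list = Sum 3 Num_verts (Sum 5 Num_edges (When (Eq (Var 5) (Corr 4))
     (Wire (Plus (Times (Neg (Eq (Var 3) (Var 4))) Size) (Pair_index 3 5)))))"

definition Choice_list :: prog where
  "Choice_list = Sum 5 Num_edges
     (When (Conj (Mem 4 5) (Neg (Conj (Eq (Fun 4) (Num 2)) (Eq (Var 5) (Corr 4)))))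
       (Wire (Pair_index 4 5)))"

definition Cover_list :: prog where
  "Cover_list = Sum 4 Num_verts (When (Mem 4 5) (Wire (Plus (Shift 0) (Var 4))))"

definition Output_list :: prog where
  "Output_list = Plus (Sum 4 Num_verts (When (Fun 4) (Wire (Plus (Shift 2) (Var 4)))))
     (Plus (Sum 4 Num_verts (When (Fun 4) (Wire (Plus (Shift 3) (Var 4)))))
       (Sum 5 Num_edges (When (Neg (Sum 3 Num_verts (Eq (Corr 3) (Var 5)))) (Wire (Plus (Shift 4) (Var 5))))))"

text \<open>
  The first bit is the list marker of \<^const>\<open>enc_list\<close>.
\<close>

definition List_gate :: "bool \<Rightarrow> prog \<Rightarrow> prog" where
  "List_gate b e = Plus (Emits [True, True, b]) (Plus e (Emit False))"

definition Circuit_prog :: prog where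
  "Circuit_prog =
     Plus (Unary Size)
    (Plus (Sum 3 Size (Plus (Emits [True, False]) (Unary (Var 3))))
    (Plus (Sum 4 Num_verts (List_gate False Conflict_list))
    (Plus (Sum 4 Num_verts (List_gate False Keep_one_list))
    (Plus (Sum 4 Num_verts (List_gate True (Plus (Wire (Plus (Shift 0) (Var 4))) (Wire (Plus (Shift 1) (Var 4))))))
    (Plus (Sum 4 Num_verts (List_gate True Choice_list))
    (Plus (Sum 5 Num_edges (List_gate True Cover_list))
    (Plus (List_gate False Output_list)
    (Plus (Emit False) (Unary (Plus (Shift 4) Num_edges))))))))))"

lemma out_sizes [simp]:
  "out A Size \<rho> = []" "out A (Pair_index y j) \<rho> = []" "out A (Shift c) \<rho> = []"
  by (simp_all add: Size_def Pair_index_def Shift_def)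

lemma val_sizes [simp]:
  assumes "\<rho> 0 = length x"
  shows "val (cells x) Size \<rho> = num_verts x * num_edges x"
    "val (cells x) (Pair_index y j) \<rho> = \<rho> y * num_edges x + \<rho> j"
    "val (cells x) (Shift c) \<rho> = 2 * (num_verts x * num_edges x) + c * num_verts x"
  using assms by (simp_all add: Size_def Pair_index_def Shift_def val_Times)

lemma out_lists:
  assumes "\<rho> 0 = length x"
  shows "out (cells x) Conflict_list \<rho> =
      enc_wires (conflict_list (num_verts x) (num_edges x) (edge_of x) (corr_of x) (\<rho> 4))"
    and "out (cells x) Keep_one_list \<rho> =
      enc_wires (keep_one_list (num_verts x) (num_edges x) (corr_of x) (\<rho> 4))"
    and "out (cells x) Choice_list \<rho> =
      enc_wires (choice_list (num_edges x) (edge_of x) (corr_of x) (fun_of x) (\<rho> 4))"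
    and "out (cells x) Cover_list \<rho> =
      enc_wires (cover_list (num_verts x) (num_edges x) (edge_of x) (\<rho> 5))"
    and "out (cells x) Output_list \<rho> =
      enc_wires (output_list (num_verts x) (num_edges x) (corr_of x) (fun_of x))"
proof -
  show "out (cells x) Conflict_list \<rho> =
      enc_wires (conflict_list (num_verts x) (num_edges x) (edge_of x) (corr_of x) (\<rho> 4))"
    using assms unfolding Conflict_list_def conflict_list_def
    by (simp add: enc_wires_simps if_distrib[of enc_wires]) (intro arg_cong[of _ _ concat] map_cong refl; auto simp: enc_wires_simps)
  show "out (cells x) Keep_one_list \<rho> =
      enc_wires (keep_one_list (num_verts x) (num_edges x) (corr_of x) (\<rho> 4))"
    using assms unfolding Keep_one_list_def keep_one_list_def
    by (simp add: enc_wires_simps if_distrib[of enc_wires])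
      (intro arg_cong[of _ _ concat] map_cong refl;
       auto simp: enc_wires_simps val_Times[where c = "num_verts x * num_edges x"])
  show "out (cells x) Choice_list \<rho> =
      enc_wires (choice_list (num_edges x) (edge_of x) (corr_of x) (fun_of x) (\<rho> 4))"
    using assms unfolding Choice_list_def choice_list_def
    by (simp add: enc_wires_simps if_distrib[of enc_wires]) (intro arg_cong[of _ _ concat] map_cong refl; auto simp: enc_wires_simps)
  show "out (cells x) Cover_list \<rho> =
      enc_wires (cover_list (num_verts x) (num_edges x) (edge_of x) (\<rho> 5))"
    using assms unfolding Cover_list_def cover_list_def
    by (simp add: enc_wires_simps if_distrib[of enc_wires]) (intro arg_cong[of _ _ concat] map_cong refl; auto simp: enc_wires_simps)
  have "(\<Sum>v<n. of_bool (corr_of x v = i)) = (0::nat) \<longleftrightarrow> i \<notin> corr_of x ` {..<n}" for n i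
    by auto
  then show "out (cells x) Output_list \<rho> =
      enc_wires (output_list (num_verts x) (num_edges x) (corr_of x) (fun_of x))"
    using assms unfolding Output_list_def output_list_def
    by (simp add: enc_wires_simps if_distrib[of enc_wires])
      (intro arg_cong2[of _ _ _ _ "(@)"] arg_cong[of _ _ concat] map_cong refl;
       auto simp: enc_wires_simps)
qed

lemma out_Circuit_prog:
  assumes "\<rho> 0 = length x"
  shows "out (cells x) Circuit_prog \<rho> = enc_circuit
    (extension_circuit (num_verts x) (num_edges x) (edge_of x) (corr_of x) (fun_of x))"
  using assms unfolding Circuit_prog_def List_gate_def enc_circuit_def extension_circuit_def enc_list_def[of enc_gate]
  by (simp add: out_lists enc_list_enc_nat enc_wires_simps comp_def)

section \<open>Correctness, parameter bound and membership in W[3]\<close>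

section \<open>The reduction\<close>

definition Support :: prog where
  "Support = Sum 3 Num_verts (Neg (Neg (Fun 3)))"

definition support :: "bool list \<Rightarrow> nat set" where
  "support x = {v. v < num_verts x \<and> fun_of x v \<noteq> 0}"

lemma val_Support: "\<rho> 0 = length x \<Longrightarrow> val (cells x) Support \<rho> = card (support x)"
  by (simp add: Support_def support_def sum_of_bool_eq lessThan_def Collect_conj_eq)

lemma out_Support [simp]: "out A Support \<rho> = []"
  by (simp add: Support_def)

definition Reduction :: prog where
  "Reduction = Plus (Unary (Times Valid Support)) (When Valid Circuit_prog)"

definition reduced_parameter :: "bool list \<Rightarrow> nat \<Rightarrow> nat" where
  "reduced_parameter x k = (if valid_instance x k then card (support x) else 0)"

text \<open>The empty word encodes no circuit and is thus a no-instance for every parameter.\<close>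

definition reduced_instance :: "bool list \<Rightarrow> nat \<Rightarrow> bool list" where
  "reduced_instance x k = (if valid_instance x k then enc_circuit
     (extension_circuit (num_verts x) (num_edges x) (edge_of x) (corr_of x) (fun_of x)) else [])"

lemma out_Reduction:
  "out (cells x) Reduction (input_env x k) = enc_nat (reduced_parameter x k) @ reduced_instance x k"
  by (simp add: Reduction_def input_env_def reduced_parameter_def reduced_instance_def
      out_Circuit_prog val_Times[where c = "card (support x)"] val_Support)

text \<open>Every vertex of the support contributes at least 1 to the weight.\<close>

lemma reduced_parameter_le: "reduced_parameter x k \<le> k"
proof (cases "valid_instance x k")
  case True
  have "card (support x) = (\<Sum>v\<in>support x. 1)" by simp
  also have "\<dots> \<le> (\<Sum>v\<in>support x. fun_of x v)" by (intro sum_mono) (auto simp: support_def)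
  also have "\<dots> \<le> (\<Sum>v<num_verts x. fun_of x v)" by (intro sum_mono2) (auto simp: support_def)
  also have "\<dots> = k" using True by (simp add: valid_instance_def)
  finally show ?thesis using True by (simp add: reduced_parameter_def)
qed (simp add: reduced_parameter_def)

text \<open>The target problem asks for some circuit with the given code; injectivity of the
  encoding identifies it with the constructed one.\<close>

lemma reduction_correct:
  "(x, k) \<in> extension_roman_hitting_function \<longleftrightarrow>
     (reduced_instance x k, reduced_parameter x k) \<in> weighted_circuit_sat 3 4"
proof (cases "valid_instance x k")
  case True
  then have "is_hypergraph (hypergraph_of x)" "correspondence (hypergraph_of x) (corr_of x)"
    "fun_of x \<in> verts (hypergraph_of x) \<rightarrow> {0, 1, 2}"
    unfolding valid_instance_iff by auto
  note sat = extension_iff_weighted_sat[OF refl refl this]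
  show ?thesis
    using True wf_extension_circuit[OF refl refl] weft_extension_circuit[OF refl refl] depth_extension_circuit[OF refl refl]
    unfolding extension_roman_hitting_function_iff weighted_circuit_sat_def reduced_instance_def
      reduced_parameter_def support_def sat
    by (auto simp: enc_circuit_inject)
next
  case False
  have "enc_circuit C \<noteq> []" for C by (simp add: enc_circuit_def enc_nat_def)
  then have "reduced_instance x k \<noteq> enc_circuit C" for C
    using False by (metis reduced_instance_def)
  then show ?thesis
    using False unfolding extension_roman_hitting_function_iff weighted_circuit_sat_def by auto
qed

text \<open>On the empty word the simulation theorem yields computability once the time bound is
  forgotten.\<close>

lemma computable_prog:
  assumes "\<And>k. out (cells []) e (input_env [] k) = enc_nat (g k)"
  shows "computable g"
proof -
  obtain P c where "\<forall>x k. halts_within P (enc_nat k @ x) (out (cells x) e (input_env x k)) ((k + length x + 2) ^ c)"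
    using prog_runs_polynomially by blast
  then have "halts_within P (enc_nat k) (enc_nat (g k)) ((k + 2) ^ c)" for k
    using assms[of k] by (metis append_Nil2 list.size(3) add_0_right)
  then show ?thesis unfolding computable_def by blast
qed

primrec Pow :: "nat \<Rightarrow> prog" where
  "Pow 0 = Num 1"
| "Pow (Suc c) = Times (Plus (Var 1) (Num 2)) (Pow c)"

lemma computable_power: "computable (\<lambda>k. (k + 2) ^ c)"
proof (rule computable_prog)
  have "out A (Pow c) \<rho> = []" "val A (Pow c) \<rho> = (\<rho> 1 + 2) ^ c" for A \<rho>
    by (induction c arbitrary: \<rho>) (auto simp: Times_def)
  then show "out (cells []) (Unary (Pow c)) (input_env [] k) = enc_nat ((k + 2) ^ c)" for k
    by (simp add: input_env_def)
qed

lemma computable_id: "computable (\<lambda>k. k)"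
  by (rule computable_prog[of "Unary (Var 1)"]) (simp add: input_env_def)

theorem theorem13:
  shows "extension_roman_hitting_function \<in> W_class 3"
proof -
  obtain P c where P: "\<And>x k. halts_within P (enc_nat k @ x) (out (cells x) Reduction (input_env x k))
      ((k + length x + 2) ^ c)"
    using prog_runs_polynomially by blast
  have "halts_within P (enc_nat k @ x) (enc_nat (reduced_parameter x k) @ reduced_instance x k)
      ((k + 2) ^ c * (length x + 1) ^ c)" for x k
  proof -
    \<comment> \<open>The bound must be split into a function of \<open>k\<close> times a power of
      \<open>length x + 1\<close>, so the sum is replaced by a product.\<close>
    have "k + length x + 2 \<le> (k + 2) * (length x + 1)" by simp
    then have "(k + length x + 2) ^ c \<le> ((k + 2) * (length x + 1)) ^ c" by (rule power_mono) simp
    then show ?thesis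
      unfolding power_mult_distrib using P[of k x] halts_within_mono unfolding out_Reduction by blast
  qed
  then have "fpt_reducible extension_roman_hitting_function (weighted_circuit_sat 3 4)"
    unfolding fpt_reducible_def
    using computable_power[of c] computable_id reduced_parameter_le reduction_correct by blast
  then show ?thesis unfolding W_class_def by blast
qed

end
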